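(* Let $C$ be a set, $H=\ell^2(C)$, and for $k\ge0$ let $H_k=\ell^2(C^k)$, $B_k$ the closed unit ball of $H_k^{S_k}$, and $R_k=\{r_1\otimes\cdots\otimes r_k\mid r_1,\ldots,r_k\in B(H)\}\subseteq H_k$. Then the orbit space $\left(\prod_{k=0}^\infty (B_k,d_{R_k})\right)/O(H)$ is compact.
   Context: $\ell^2(X)$ is the real Hilbert space of square-summable functions $X\to\mathbb{R}$; $B(H)$ is the closed unit ball of $H$; $S_k$ acts on $H_k$ by permuting coordinates and $H_k^{S_k}$ is the set of invariant elements; $(r_1\otimes\cdots\otimes r_k)(c_1,\ldots,c_k)=\prod_i r_i(c_i)$. The orthogonal group $O(H)$ acts on $H_k$ by the continuous extension of $g\mapsto g^{\otimes k}$ from $H^{\otimes k}$ (dense in $H_k$) to $H_k=\ell^2(C^k)$; it preserves $B_k$ and acts diagonally on the product. For $R\subseteq H_k$, $d_R(x,y)=\sup_{r\in R}|\langle r,x-y\rangle|$; $(B_k,d_{R_k})$ carries the topology of this pseudometric and the product carries the product topology. The orbit space is the quotient by the $O(H)$-orbits. *)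

theory Defs
  imports "HOL-Analysis.Analysis" "HOL-Combinatorics.Permutations"
begin

section \<open>The Hilbert space of square-summable functions\<close>

typedef 'a ell2 = "{f :: 'a \<Rightarrow> real. (\<lambda>a. (f a)\<^sup>2) summable_on UNIV}"
  morphisms ell2_at Abs_ell2
  by (rule exI[of _ "\<lambda>_. 0"]) simp

setup_lifting type_definition_ell2

lemma ell2_summable_sq: "(\<lambda>a. (ell2_at x a)\<^sup>2) summable_on UNIV"
  using ell2_at[of x] by simp

lemma summable_on_sq_product:
  fixes f g :: "'a \<Rightarrow> real"
  assumes "(\<lambda>a. (f a)\<^sup>2) summable_on A" "(\<lambda>a. (g a)\<^sup>2) summable_on A"
  shows "(\<lambda>a. f a * g a) summable_on A"
proof -
  have "(\<lambda>a. norm (f a * g a)) summable_on A"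
  proof (rule summable_on_comparison_test)
    show "(\<lambda>a. (f a)\<^sup>2 + (g a)\<^sup>2) summable_on A"
      by (intro summable_on_add assms)
    fix a
    have "2 * \<bar>f a\<bar> * \<bar>g a\<bar> \<le> \<bar>f a\<bar>\<^sup>2 + \<bar>g a\<bar>\<^sup>2"
      by (rule sum_squares_bound)
    moreover have "0 \<le> \<bar>f a\<bar> * \<bar>g a\<bar>" by simp
    ultimately have "\<bar>f a\<bar> * \<bar>g a\<bar> \<le> (f a)\<^sup>2 + (g a)\<^sup>2"
      unfolding power2_abs by linarith
    then show "norm (f a * g a) \<le> (f a)\<^sup>2 + (g a)\<^sup>2"
      by (simp add: abs_mult)
  qed simp
  then show ?thesis by (rule abs_summable_summable)
qed

lemma summable_on_sq_add:
  fixes f g :: "'a \<Rightarrow> real"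
  assumes "(\<lambda>a. (f a)\<^sup>2) summable_on A" "(\<lambda>a. (g a)\<^sup>2) summable_on A"
  shows "(\<lambda>a. (f a + g a)\<^sup>2) summable_on A"
proof -
  have "(\<lambda>a. (f a)\<^sup>2 + (g a)\<^sup>2 + 2 * (f a * g a)) summable_on A"
    by (intro summable_on_add summable_on_cmult_right summable_on_sq_product assms)
  then show ?thesis by (simp add: power2_sum mult.assoc)
qed

lemma ell2_eqI: "(\<And>a. ell2_at x a = ell2_at y a) \<Longrightarrow> x = y"
  by (simp add: ell2_at_inject[symmetric] fun_eq_iff)

instantiation ell2 :: (type) real_vector
begin

lift_definition zero_ell2 :: "'a ell2" is "\<lambda>_. 0" by simp

lift_definition plus_ell2 :: "'a ell2 \<Rightarrow> 'a ell2 \<Rightarrow> 'a ell2" is "\<lambda>f g a. f a + g a"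
  by (rule summable_on_sq_add)

lift_definition uminus_ell2 :: "'a ell2 \<Rightarrow> 'a ell2" is "\<lambda>f a. - f a" by simp

lift_definition minus_ell2 :: "'a ell2 \<Rightarrow> 'a ell2 \<Rightarrow> 'a ell2" is "\<lambda>f g a. f a - g a"
proof -
  fix f g :: "'a \<Rightarrow> real"
  assume "(\<lambda>a. (f a)\<^sup>2) summable_on UNIV" "(\<lambda>a. (g a)\<^sup>2) summable_on UNIV"
  then show "(\<lambda>a. (f a - g a)\<^sup>2) summable_on UNIV"
    using summable_on_sq_add[of f UNIV "\<lambda>a. - g a"] by simp
qed

lift_definition scaleR_ell2 :: "real \<Rightarrow> 'a ell2 \<Rightarrow> 'a ell2" is "\<lambda>r f a. r * f a"
  by (auto simp: power_mult_distrib intro: summable_on_cmult_right)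

instance
proof
  fix x y z :: "'a ell2" and r s :: real
  note rep = zero_ell2.rep_eq plus_ell2.rep_eq uminus_ell2.rep_eq minus_ell2.rep_eq scaleR_ell2.rep_eq
  show "x + y + z = x + (y + z)" "x + y = y + x" "0 + x = x" "- x + x = 0" "x - y = x + - y"
    "r *\<^sub>R (x + y) = r *\<^sub>R x + r *\<^sub>R y" "(r + s) *\<^sub>R x = r *\<^sub>R x + s *\<^sub>R x"
    "r *\<^sub>R s *\<^sub>R x = (r * s) *\<^sub>R x" "1 *\<^sub>R x = x"
    by (rule ell2_eqI; simp add: rep algebra_simps)+
qed

end

instantiation ell2 :: (type) real_inner
begin

definition inner_ell2 :: "'a ell2 \<Rightarrow> 'a ell2 \<Rightarrow> real" where
  "inner x y = (\<Sum>\<^sub>\<infinity>a. ell2_at x a * ell2_at y a)"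

definition norm_ell2 :: "'a ell2 \<Rightarrow> real" where
  "norm (x :: 'a ell2) = sqrt (inner x x)"

definition dist_ell2 :: "'a ell2 \<Rightarrow> 'a ell2 \<Rightarrow> real" where
  "dist (x :: 'a ell2) y = norm (x - y)"

definition sgn_ell2 :: "'a ell2 \<Rightarrow> 'a ell2" where
  "sgn (x :: 'a ell2) = x /\<^sub>R norm x"

definition uniformity_ell2 :: "('a ell2 \<times> 'a ell2) filter" where
  "uniformity = (INF e\<in>{0<..}. principal {(x, y). dist x (y :: 'a ell2) < e})"

definition open_ell2 :: "'a ell2 set \<Rightarrow> bool" where
  "open (U :: 'a ell2 set) = (\<forall>x\<in>U. \<forall>\<^sub>F (x', y) in uniformity. x' = x \<longrightarrow> y \<in> U)"

instance
proof
  fix x y z :: "'a ell2" and r :: real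
  note prod = summable_on_sq_product[OF ell2_summable_sq ell2_summable_sq]
  show "dist x y = norm (x - y)" by (rule dist_ell2_def)
  show "sgn x = x /\<^sub>R norm x" by (rule sgn_ell2_def)
  show "uniformity = (INF e\<in>{0<..}. principal {(x, y). dist x (y :: 'a ell2) < e})"
    by (rule uniformity_ell2_def)
  show "open U = (\<forall>x\<in>U. \<forall>\<^sub>F (x', y) in uniformity. x' = x \<longrightarrow> y \<in> U)" for U :: "'a ell2 set"
    by (rule open_ell2_def)
  show "inner x y = inner y x" by (simp add: inner_ell2_def mult.commute)
  show "inner (x + y) z = inner x z + inner y z"
    by (simp add: inner_ell2_def plus_ell2.rep_eq distrib_right infsum_add prod)
  show "inner (r *\<^sub>R x) y = r * inner x y"
    by (simp add: inner_ell2_def scaleR_ell2.rep_eq mult.assoc infsum_cmult_right')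
  show "0 \<le> inner x x" by (simp add: inner_ell2_def infsum_nonneg)
  show "norm x = sqrt (inner x x)" by (rule norm_ell2_def)
  show "inner x x = 0 \<longleftrightarrow> x = 0"
  proof
    assume "inner x x = 0"
    then have "ell2_at x a * ell2_at x a = 0" for a
      using nonneg_infsum_le_0D[of "\<lambda>a. ell2_at x a * ell2_at x a" UNIV a] prod[of x x]
      by (simp add: inner_ell2_def)
    then show "x = 0" by (intro ell2_eqI) (simp add: zero_ell2.rep_eq)
  qed (simp add: inner_ell2_def zero_ell2.rep_eq)
qed

end

lemma ell2_inner_summable: "(\<lambda>a. ell2_at x a * ell2_at y a) summable_on UNIV"
  by (rule summable_on_sq_product[OF ell2_summable_sq ell2_summable_sq])

lemma ell2_norm_sq: "(norm x)\<^sup>2 = (\<Sum>\<^sub>\<infinity>a. (ell2_at x a)\<^sup>2)" for x :: "'a ell2"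
  by (simp add: power2_norm_eq_inner inner_ell2_def flip: power2_eq_square)

lemma ell2_sum_le_norm:
  assumes "finite F"
  shows "(\<Sum>a\<in>F. (ell2_at x a)\<^sup>2) \<le> (norm x)\<^sup>2"
  unfolding ell2_norm_sq
  using assms by (intro finite_sum_le_infsum ell2_summable_sq) auto

lemma ell2_at_le_norm: "\<bar>ell2_at x a\<bar> \<le> norm x"
  using ell2_sum_le_norm[of "{a}" x] by (simp add: abs_le_square_iff[symmetric])

instance ell2 :: (type) complete_space
proof
  fix X :: "nat \<Rightarrow> 'a ell2"
  assume X: "Cauchy X"
  have "Cauchy (\<lambda>n. ell2_at (X n) a)" for a
  proof (rule metric_CauchyI)
    fix e :: real assume "0 < e"
    then obtain N where N: "\<And>m n. m \<ge> N \<Longrightarrow> n \<ge> N \<Longrightarrow> dist (X m) (X n) < e"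
      using X metric_CauchyD by blast
    have "dist (ell2_at (X m) a) (ell2_at (X n) a) \<le> dist (X m) (X n)" for m n
      using ell2_at_le_norm[of "X m - X n" a] by (simp add: dist_norm minus_ell2.rep_eq)
    with N show "\<exists>N. \<forall>m\<ge>N. \<forall>n\<ge>N. dist (ell2_at (X m) a) (ell2_at (X n) a) < e"
      by (meson order_le_less_trans)
  qed
  then have "\<forall>a. \<exists>l. (\<lambda>n. ell2_at (X n) a) \<longlonglongrightarrow> l"
    by (simp add: Cauchy_convergent_iff convergent_def)
  then obtain f where f: "\<And>a. (\<lambda>n. ell2_at (X n) a) \<longlonglongrightarrow> f a" by metis
  have bound: "(\<Sum>a\<in>F. (ell2_at (X n) a - f a)\<^sup>2) \<le> e\<^sup>2"
    if N: "\<And>m n. m \<ge> N \<Longrightarrow> n \<ge> N \<Longrightarrow> dist (X m) (X n) < e" and "n \<ge> N" "finite F" for N e n F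
  proof (rule LIMSEQ_le_const2)
    show "(\<lambda>m. \<Sum>a\<in>F. (ell2_at (X n) a - ell2_at (X m) a)\<^sup>2) \<longlonglongrightarrow> (\<Sum>a\<in>F. (ell2_at (X n) a - f a)\<^sup>2)"
      by (intro tendsto_intros f)
    show "\<exists>N. \<forall>m\<ge>N. (\<Sum>a\<in>F. (ell2_at (X n) a - ell2_at (X m) a)\<^sup>2) \<le> e\<^sup>2"
    proof (intro exI allI impI)
      fix m assume "m \<ge> N"
      have "(\<Sum>a\<in>F. (ell2_at (X n) a - ell2_at (X m) a)\<^sup>2) \<le> (norm (X n - X m))\<^sup>2"
        using ell2_sum_le_norm[OF \<open>finite F\<close>, of "X n - X m"] by (simp add: minus_ell2.rep_eq)
      also have "\<dots> \<le> e\<^sup>2"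
        using N[OF \<open>n \<ge> N\<close> \<open>m \<ge> N\<close>] by (intro power_mono) (auto simp: dist_norm)
      finally show "(\<Sum>a\<in>F. (ell2_at (X n) a - ell2_at (X m) a)\<^sup>2) \<le> e\<^sup>2" .
    qed
  qed
  have diff: "(\<lambda>a. (ell2_at (X n) a - f a)\<^sup>2) summable_on UNIV \<and>
      (\<Sum>\<^sub>\<infinity>a. (ell2_at (X n) a - f a)\<^sup>2) \<le> e\<^sup>2"
    if "\<And>m n. m \<ge> N \<Longrightarrow> n \<ge> N \<Longrightarrow> dist (X m) (X n) < e" and "n \<ge> N" for N e n
  proof
    show *: "(\<lambda>a. (ell2_at (X n) a - f a)\<^sup>2) summable_on UNIV"
      using bound[OF that] by (intro nonneg_bdd_above_summable_on) (auto intro!: bdd_aboveI2)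
    show "(\<Sum>\<^sub>\<infinity>a. (ell2_at (X n) a - f a)\<^sup>2) \<le> e\<^sup>2"
      using bound[OF that] by (intro infsum_le_finite_sums *) auto
  qed
  obtain N0 where "\<And>m n. m \<ge> N0 \<Longrightarrow> n \<ge> N0 \<Longrightarrow> dist (X m) (X n) < 1"
    using X metric_CauchyD[of X 1] by auto
  from diff[OF this, of N0] have "(\<lambda>a. (f a - ell2_at (X N0) a)\<^sup>2) summable_on UNIV"
    by (simp add: power2_commute)
  from summable_on_sq_add[OF this ell2_summable_sq[of "X N0"]]
  have "(\<lambda>a. (f a)\<^sup>2) summable_on UNIV" by simp
  then obtain L where L: "ell2_at L = f" using Abs_ell2_inverse by blast
  have "X \<longlonglongrightarrow> L"
  proof (rule metric_LIMSEQ_I)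
    fix e :: real assume "0 < e"
    then obtain N where N: "\<And>m n. m \<ge> N \<Longrightarrow> n \<ge> N \<Longrightarrow> dist (X m) (X n) < e / 2"
      using X metric_CauchyD[of X "e / 2"] by (metis half_gt_zero)
    have "dist (X n) L < e" if "n \<ge> N" for n
    proof -
      have "(norm (X n - L))\<^sup>2 \<le> (e / 2)\<^sup>2"
        unfolding ell2_norm_sq using diff[OF N that] L by (simp add: minus_ell2.rep_eq)
      then have "norm (X n - L) \<le> e / 2"
        using \<open>0 < e\<close> by (intro power2_le_imp_le[of "norm (X n - L)"]) auto
      then show ?thesis using \<open>0 < e\<close> by (simp add: dist_norm)
    qed
    then show "\<exists>no. \<forall>n\<ge>no. dist (X n) L < e" by blast
  qed
  then show "convergent X" by (auto simp: convergent_def)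
qed


definition ell2_delta :: "'a \<Rightarrow> 'a ell2" where
  "ell2_delta a = Abs_ell2 (\<lambda>b. if b = a then 1 else 0)"

lemma ell2_at_delta: "ell2_at (ell2_delta a) b = (if b = a then 1 else 0)"
proof -
  have "(\<lambda>b. (if b = a then 1 else 0 :: real)\<^sup>2) summable_on UNIV"
    by (rule finite_nonzero_values_imp_summable_on) (simp add: if_distrib)
  then show ?thesis by (simp add: ell2_delta_def Abs_ell2_inverse)
qed

lemma inner_delta: "inner (ell2_delta a) x = ell2_at x a"
proof -
  have "inner (ell2_delta a) x = (\<Sum>\<^sub>\<infinity>b\<in>{a}. ell2_at (ell2_delta a) b * ell2_at x b)"
    unfolding inner_ell2_def by (rule infsum_cong_neutral) (auto simp: ell2_at_delta)
  then show ?thesis by (simp add: ell2_at_delta)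
qed

lemma norm_delta: "norm (ell2_delta a) = 1"
  by (simp add: norm_eq_sqrt_inner inner_delta ell2_at_delta)

text \<open>For a subset \<open>X\<close> of the index type, \<open>\<ell>\<^sup>2(X)\<close> is identified with the closed subspace of
  functions vanishing outside \<open>X\<close>.\<close>

definition ell2_on :: "'a set \<Rightarrow> 'a ell2 set" where
  "ell2_on X = {x. \<forall>a. a \<notin> X \<longrightarrow> ell2_at x a = 0}"

lemma subspace_ell2_on: "subspace (ell2_on X)"
  by (rule subspaceI) (auto simp: ell2_on_def zero_ell2.rep_eq plus_ell2.rep_eq scaleR_ell2.rep_eq)

lemma closed_ell2_on: "closed (ell2_on X)"
proof -
  have "ell2_on X = (\<Inter>a\<in>-X. {x. inner (ell2_delta a) x = 0})"
    by (auto simp: ell2_on_def inner_delta)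
  also have "closed \<dots>"
    by (intro closed_INT ballI closed_Collect_eq continuous_intros)
  finally show ?thesis .
qed

lemma ell2_on_closure_span: "ell2_on X = closure (span (ell2_delta ` X))"
proof
  have "ell2_delta ` X \<subseteq> ell2_on X"
    by (auto simp: ell2_on_def ell2_at_delta)
  then show "closure (span (ell2_delta ` X)) \<subseteq> ell2_on X"
    by (intro closure_minimal span_minimal subspace_ell2_on closed_ell2_on)
  show "ell2_on X \<subseteq> closure (span (ell2_delta ` X))"
  proof
    fix x assume x: "x \<in> ell2_on X"
    show "x \<in> closure (span (ell2_delta ` X))"
      unfolding closure_approachable
    proof (intro allI impI)
      fix e :: real assume "0 < e"
      then have "0 < (e / 2)\<^sup>2" by simp
      have "((\<lambda>a. (ell2_at x a)\<^sup>2) has_sum (norm x)\<^sup>2) UNIV"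
        unfolding ell2_norm_sq by (rule has_sum_infsum[OF ell2_summable_sq])
      from has_sum_finite_approximation[OF this \<open>0 < (e / 2)\<^sup>2\<close>]
      obtain F where F: "finite F" and
        "dist (\<Sum>a\<in>F. (ell2_at x a)\<^sup>2) ((norm x)\<^sup>2) \<le> (e / 2)\<^sup>2" by auto
      then have le: "(norm x)\<^sup>2 - (\<Sum>a\<in>F. (ell2_at x a)\<^sup>2) \<le> (e / 2)\<^sup>2"
        by (auto simp: dist_real_def)
      define y where "y = (\<Sum>a\<in>F. ell2_at x a *\<^sub>R ell2_delta a)"
      have "ell2_at x a *\<^sub>R ell2_delta a \<in> span (ell2_delta ` X)" for a
        using x by (cases "a \<in> X") (auto simp: ell2_on_def span_zero intro: span_scale span_base)
      then have y: "y \<in> span (ell2_delta ` X)"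
        unfolding y_def by (intro span_sum)
      have yx: "inner y x = (\<Sum>a\<in>F. (ell2_at x a)\<^sup>2)"
        by (simp add: y_def inner_sum_left inner_delta power2_eq_square)
      have aty: "ell2_at y a = ell2_at x a" if "a \<in> F" for a
      proof -
        have "ell2_at y a = (\<Sum>b\<in>F. ell2_at x b * inner (ell2_delta a) (ell2_delta b))"
          by (simp add: y_def flip: inner_delta) (simp add: inner_sum_right)
        also have "\<dots> = (\<Sum>b\<in>F. if a = b then ell2_at x b else 0)"
          by (intro sum.cong) (auto simp: inner_delta ell2_at_delta)
        also have "\<dots> = ell2_at x a" using F that by simp
        finally show ?thesis .
      qed
      have "inner y y = (\<Sum>a\<in>F. ell2_at x a * ell2_at y a)"
        by (subst y_def) (simp add: inner_sum_left inner_delta)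
      also have "\<dots> = (\<Sum>a\<in>F. (ell2_at x a)\<^sup>2)"
        using aty by (intro sum.cong) (auto simp: power2_eq_square)
      finally have yy: "inner y y = (\<Sum>a\<in>F. (ell2_at x a)\<^sup>2)" .
      have "(dist y x)\<^sup>2 = (norm x)\<^sup>2 - (\<Sum>a\<in>F. (ell2_at x a)\<^sup>2)"
        by (simp add: dist_norm power2_norm_eq_inner inner_diff_left inner_diff_right yx yy
            inner_commute[of x y])
      with le have "(dist y x)\<^sup>2 \<le> (e / 2)\<^sup>2" by simp
      then have "dist y x \<le> e / 2"
        using \<open>0 < e\<close> by (intro power2_le_imp_le[of "dist y x"]) auto
      then have "dist y x < e" using \<open>0 < e\<close> by simp
      with y show "\<exists>y\<in>span (ell2_delta ` X). dist y x < e" by blast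
    qed
  qed
qed

section \<open>Tensor products\<close>

definition tuples :: "nat \<Rightarrow> 'a set \<Rightarrow> 'a list set" where
  "tuples k A = {xs. length xs = k \<and> set xs \<subseteq> A}"

lemma in_tuples_UNIV: "xs \<in> tuples k UNIV \<longleftrightarrow> length xs = k"
  by (simp add: tuples_def)

lemma tuples_Suc_eq: "tuples (Suc n) UNIV = (\<lambda>(c, cs). c # cs) ` (UNIV \<times> tuples n UNIV)"
proof (intro equalityI subsetI)
  fix xs :: "'a list" assume "xs \<in> tuples (Suc n) UNIV"
  then obtain c cs where "xs = c # cs" "cs \<in> tuples n UNIV"
    by (cases xs) (auto simp: in_tuples_UNIV)
  then show "xs \<in> (\<lambda>(c, cs). c # cs) ` (UNIV \<times> tuples n UNIV)"
    by (intro image_eqI[of _ _ "(c, cs)"]) auto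
qed (auto simp: in_tuples_UNIV)

lemma has_sum_prod_lists:
  fixes fs :: "('a \<Rightarrow> real) list"
  assumes "\<And>f. f \<in> set fs \<Longrightarrow> (\<lambda>c. norm (f c)) summable_on UNIV"
  shows "(\<lambda>cs. norm (\<Prod>i<length fs. (fs ! i) (cs ! i))) summable_on tuples (length fs) UNIV \<and>
    ((\<lambda>cs. \<Prod>i<length fs. (fs ! i) (cs ! i)) has_sum (\<Prod>i<length fs. infsum (fs ! i) UNIV))
      (tuples (length fs) UNIV)"
  using assms
proof (induction fs)
  case Nil
  have "tuples 0 UNIV = {[] :: 'a list}" by (auto simp: tuples_def)
  then show ?case using has_sum_finite[of "{[]}" "\<lambda>_ :: 'a list. 1 :: real"] by simp
next
  case (Cons f fs)
  let ?n = "length fs"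
  let ?P = "\<lambda>cs. \<Prod>i<?n. (fs ! i) (cs ! i)"
  let ?Q = "\<lambda>cs. \<Prod>i<Suc ?n. ((f # fs) ! i) (cs ! i)"
  have f: "(\<lambda>c. norm (f c)) summable_on UNIV" using Cons.prems by simp
  have IH: "(\<lambda>cs. norm (?P cs)) summable_on tuples ?n UNIV"
    "(?P has_sum (\<Prod>i<?n. infsum (fs ! i) UNIV)) (tuples ?n UNIV)"
    using Cons by auto
  have eq: "?Q \<circ> (\<lambda>(c, cs). c # cs) = (\<lambda>(c, cs). f c * ?P cs)"
    by (auto simp: fun_eq_iff prod.lessThan_Suc_shift simp del: prod.lessThan_Suc)
  have inj: "inj_on (\<lambda>(c, cs). c # cs) (UNIV \<times> tuples ?n UNIV)"
    by (auto simp: inj_on_def)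
  have abs: "(\<lambda>p. norm (case p of (c, cs) \<Rightarrow> f c * ?P cs)) summable_on (UNIV \<times> tuples ?n UNIV)"
  proof (rule summable_on_SigmaI)
    show "((\<lambda>cs. norm (case (c, cs) of (c, cs) \<Rightarrow> f c * ?P cs)) has_sum
        norm (f c) * infsum (\<lambda>cs. norm (?P cs)) (tuples ?n UNIV)) (tuples ?n UNIV)" for c
      using has_sum_cmult_right[OF has_sum_infsum[OF IH(1)], of "norm (f c)"]
      by (simp add: abs_mult)
    show "(\<lambda>c. norm (f c) * infsum (\<lambda>cs. norm (?P cs)) (tuples ?n UNIV)) summable_on UNIV"
      using f by (intro summable_on_cmult_left)
  qed simp
  have "((\<lambda>(c, cs). f c * ?P cs) has_sum (infsum f UNIV * (\<Prod>i<?n. infsum (fs ! i) UNIV)))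
      (UNIV \<times> tuples ?n UNIV)"
  proof (rule has_sum_SigmaI)
    show "((\<lambda>cs. case (c, cs) of (c, cs) \<Rightarrow> f c * ?P cs) has_sum
        f c * (\<Prod>i<?n. infsum (fs ! i) UNIV)) (tuples ?n UNIV)" for c
      using has_sum_cmult_right[OF IH(2), of "f c"] by simp
    show "((\<lambda>c. f c * (\<Prod>i<?n. infsum (fs ! i) UNIV)) has_sum
        infsum f UNIV * (\<Prod>i<?n. infsum (fs ! i) UNIV)) UNIV"
      by (rule has_sum_cmult_left[OF has_sum_infsum[OF abs_summable_summable[OF f]]])
    show "(\<lambda>(c, cs). f c * ?P cs) summable_on UNIV \<times> tuples ?n UNIV"
      using abs by (rule abs_summable_summable)
  qed
  then have "(?Q has_sum (infsum f UNIV * (\<Prod>i<?n. infsum (fs ! i) UNIV))) (tuples (Suc ?n) UNIV)"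
    by (simp only: tuples_Suc_eq has_sum_reindex[OF inj] eq)
  moreover have "(\<lambda>cs. norm (?Q cs)) summable_on tuples (Suc ?n) UNIV"
  proof -
    have "(\<lambda>cs. norm (?Q cs)) \<circ> (\<lambda>(c, cs). c # cs) =
        (\<lambda>p. norm ((?Q \<circ> (\<lambda>(c, cs). c # cs)) p))"
      by (simp add: fun_eq_iff)
    then show ?thesis
      using abs by (simp only: tuples_Suc_eq summable_on_reindex[OF inj] eq)
  qed
  ultimately show ?case by (simp add: prod.lessThan_Suc_shift del: prod.lessThan_Suc)
qed

definition tensor :: "'a ell2 list \<Rightarrow> 'a list ell2" where
  "tensor rs = Abs_ell2 (\<lambda>cs. if length cs = length rs
     then \<Prod>i<length rs. ell2_at (rs ! i) (cs ! i) else 0)"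

lemma ell2_at_tensor:
  "ell2_at (tensor rs) cs =
    (if length cs = length rs then \<Prod>i<length rs. ell2_at (rs ! i) (cs ! i) else 0)"
proof -
  let ?fs = "map (\<lambda>r a. (ell2_at r a)\<^sup>2) rs"
  have "(\<lambda>cs. \<Prod>i<length ?fs. (?fs ! i) (cs ! i)) summable_on tuples (length ?fs) UNIV"
    by (rule abs_summable_summable[OF has_sum_prod_lists[THEN conjunct1]])
      (auto simp: ell2_summable_sq)
  also have "(\<lambda>cs. \<Prod>i<length ?fs. (?fs ! i) (cs ! i)) summable_on tuples (length ?fs) UNIV \<longleftrightarrow>
      (\<lambda>cs. (if length cs = length rs
         then \<Prod>i<length rs. ell2_at (rs ! i) (cs ! i) else 0)\<^sup>2) summable_on UNIV"
    by (rule summable_on_cong_neutral) (auto simp: in_tuples_UNIV prod_power_distrib)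
  finally show ?thesis by (simp add: tensor_def Abs_ell2_inverse)
qed

lemma inner_tensor:
  assumes "length rs = length ss"
  shows "inner (tensor rs) (tensor ss) = (\<Prod>i<length rs. inner (rs ! i) (ss ! i))"
proof -
  let ?fs = "map (\<lambda>(r, s) a. ell2_at r a * ell2_at s a) (zip rs ss)"
  have "((\<lambda>cs. \<Prod>i<length ?fs. (?fs ! i) (cs ! i)) has_sum (\<Prod>i<length ?fs. infsum (?fs ! i) UNIV))
      (tuples (length ?fs) UNIV)"
  proof (rule has_sum_prod_lists[THEN conjunct2])
    fix f assume "f \<in> set ?fs"
    then obtain r s :: "'a ell2" where "f = (\<lambda>a. ell2_at r a * ell2_at s a)" by auto
    then show "(\<lambda>c. norm (f c)) summable_on UNIV"
      using ell2_inner_summable[of r s, THEN iffD1[OF summable_on_iff_abs_summable_on_real]] by simp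
  qed
  then have "(\<Sum>\<^sub>\<infinity>cs\<in>tuples (length ?fs) UNIV. \<Prod>i<length ?fs. (?fs ! i) (cs ! i)) =
      (\<Prod>i<length ?fs. infsum (?fs ! i) UNIV)"
    by (rule infsumI)
  also have "\<dots> = (\<Prod>i<length rs. inner (rs ! i) (ss ! i))"
    using assms by (intro prod.cong) (auto simp: inner_ell2_def)
  also have "(\<Sum>\<^sub>\<infinity>cs\<in>tuples (length ?fs) UNIV. \<Prod>i<length ?fs. (?fs ! i) (cs ! i)) =
      inner (tensor rs) (tensor ss)"
    unfolding inner_ell2_def using assms
    by (intro infsum_cong_neutral) (auto simp: in_tuples_UNIV ell2_at_tensor prod.distrib)
  finally show ?thesis .
qed

lemma norm_tensor: "norm (tensor rs) = (\<Prod>i<length rs. norm (rs ! i))"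
proof (rule power2_eq_imp_eq)
  show "(norm (tensor rs))\<^sup>2 = (\<Prod>i<length rs. norm (rs ! i))\<^sup>2"
    by (simp only: prod_power_distrib power2_norm_eq_inner inner_tensor)
qed (auto intro: prod_nonneg)

lemma tensor_delta: "tensor (map ell2_delta cs) = ell2_delta cs"
proof (rule ell2_eqI)
  fix ds
  have *: "(\<Prod>i<length cs. ell2_at (ell2_delta (cs ! i)) (ds ! i)) = (if ds = cs then 1 else 0)"
    if len: "length ds = length cs"
  proof (cases "ds = cs")
    case False
    then obtain i where "i < length cs" "ds ! i \<noteq> cs ! i"
      using len by (auto simp: list_eq_iff_nth_eq)
    then have "\<exists>i\<in>{..<length cs}. ell2_at (ell2_delta (cs ! i)) (ds ! i) = 0"
      by (auto simp: ell2_at_delta)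
    then show ?thesis using False by (simp only: prod_zero[OF finite_lessThan] if_False)
  qed (simp add: ell2_at_delta)
  have "(\<Prod>i<length cs. ell2_at (map ell2_delta cs ! i) (ds ! i)) =
      (\<Prod>i<length cs. ell2_at (ell2_delta (cs ! i)) (ds ! i))"
    by (intro prod.cong) auto
  then show "ell2_at (tensor (map ell2_delta cs)) ds = ell2_at (ell2_delta cs) ds"
    using * by (cases "length ds = length cs")
      (auto simp only: ell2_at_tensor length_map ell2_at_delta if_True if_False refl split: if_splits)
qed

text \<open>\<open>C\<^sup>k\<close> is rendered as the set of lists of length \<open>k\<close> over \<open>C\<close>; thus
  \<open>ell2_on C\<close> is \<open>H\<close> and \<open>tensor_space C k\<close> is \<open>H\<^sub>k\<close>.\<close>

definition tensor_space :: "'c set \<Rightarrow> nat \<Rightarrow> 'c list ell2 set" where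
  "tensor_space C k = ell2_on (tuples k C)"

lemma tensor_in_tensor_space:
  assumes "rs \<in> tuples k (ell2_on C)"
  shows "tensor rs \<in> tensor_space C k"
  unfolding tensor_space_def ell2_on_def
proof (intro CollectI allI impI)
  fix cs assume cs: "cs \<notin> tuples k C"
  have "\<exists>i<length rs. ell2_at (rs ! i) (cs ! i) = 0" if "length cs = length rs"
  proof -
    have "\<not> set cs \<subseteq> C" using cs assms that by (auto simp: tuples_def)
    then obtain i where "i < length cs" "cs ! i \<notin> C" by (auto simp: set_conv_nth)
    moreover have "rs ! i \<in> ell2_on C"
      using assms that \<open>i < length cs\<close> by (auto simp: tuples_def)
    ultimately show ?thesis using that by (auto simp: ell2_on_def)
  qed
  then show "ell2_at (tensor rs) cs = 0" by (auto simp: ell2_at_tensor)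
qed

lemma tensor_space_closure_span:
  "tensor_space C k = closure (span (tensor ` tuples k (ell2_on C)))"
proof
  have "ell2_delta ` tuples k C \<subseteq> tensor ` tuples k (ell2_on C)"
  proof (rule image_subsetI)
    fix cs assume "cs \<in> tuples k C"
    then have "map ell2_delta cs \<in> tuples k (ell2_on C)"
      by (auto simp: tuples_def ell2_on_def ell2_at_delta)
    then show "ell2_delta cs \<in> tensor ` tuples k (ell2_on C)"
      by (metis tensor_delta image_eqI)
  qed
  then show "tensor_space C k \<subseteq> closure (span (tensor ` tuples k (ell2_on C)))"
    unfolding tensor_space_def ell2_on_closure_span by (intro closure_mono span_mono)
  have "tensor ` tuples k (ell2_on C) \<subseteq> ell2_on (tuples k C)"
    using tensor_in_tensor_space by (auto simp: tensor_space_def)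
  then show "closure (span (tensor ` tuples k (ell2_on C))) \<subseteq> tensor_space C k"
    unfolding tensor_space_def by (intro closure_minimal span_minimal subspace_ell2_on closed_ell2_on)
qed

section \<open>The spaces \<open>(B\<^sub>k, d\<^sub>R)\<close>\<close>

definition sym_tensor_space :: "'c set \<Rightarrow> nat \<Rightarrow> 'c list ell2 set" where
  "sym_tensor_space C k = {x \<in> tensor_space C k. \<forall>\<pi>. \<pi> permutes {..<k} \<longrightarrow>
     (\<forall>cs\<in>tuples k C. ell2_at x (permute_list \<pi> cs) = ell2_at x cs)}"

definition sym_ball :: "'c set \<Rightarrow> nat \<Rightarrow> 'c list ell2 set" where
  "sym_ball C k = sym_tensor_space C k \<inter> cball 0 1"

definition pure_tensors :: "'c set \<Rightarrow> nat \<Rightarrow> 'c list ell2 set" where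
  "pure_tensors C k = tensor ` tuples k (ell2_on C \<inter> cball 0 1)"

text \<open>The supremum is a real one, so this is meaningful for nonempty bounded \<open>R\<close> only.\<close>

definition dual_dist :: "'a::real_inner set \<Rightarrow> 'a \<Rightarrow> 'a \<Rightarrow> real" where
  "dual_dist R x y = (SUP r\<in>R. \<bar>inner r (x - y)\<bar>)"

lemma pure_tensors_nonempty: "pure_tensors C k \<noteq> {}"
proof -
  have "replicate k 0 \<in> tuples k (ell2_on C \<inter> cball 0 1)"
    by (auto simp: tuples_def subspace_0[OF subspace_ell2_on])
  then show ?thesis by (auto simp: pure_tensors_def)
qed

lemma pure_tensors_norm:
  assumes "r \<in> pure_tensors C k"
  shows "norm r \<le> 1"
proof -
  obtain rs where r: "r = tensor rs" "rs \<in> tuples k (ell2_on C \<inter> cball 0 1)"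
    using assms by (auto simp: pure_tensors_def)
  have "norm (rs ! i) \<le> 1" if "i < length rs" for i
    using nth_mem[OF that] r(2) by (auto simp: tuples_def)
  then show ?thesis unfolding r(1) norm_tensor by (intro prod_le_1) auto
qed

lemma bdd_above_pure_tensors: "bdd_above ((\<lambda>r. \<bar>inner r z\<bar>) ` pure_tensors C k)"
proof (rule bdd_aboveI2)
  fix r assume "r \<in> pure_tensors C k"
  then have "norm r * norm z \<le> 1 * norm z"
    by (intro mult_right_mono pure_tensors_norm norm_ge_zero)
  with Cauchy_Schwarz_ineq2[of r z] show "\<bar>inner r z\<bar> \<le> norm z"
    by linarith
qed

text \<open>The pseudometric \<open>d\<^sub>R\<close> is in fact a metric on \<open>B\<^sub>k\<close>, so its topology is an instance of the
  metric topology of the library.\<close>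

lemma Metric_space_sym_ball: "Metric_space (sym_ball C k) (dual_dist (pure_tensors C k))"
proof
  let ?R = "pure_tensors C k"
  have upper: "\<bar>inner r (x - y)\<bar> \<le> dual_dist ?R x y" if "r \<in> ?R" for r x y
    unfolding dual_dist_def by (rule cSUP_upper[OF that bdd_above_pure_tensors])
  fix x y :: "'a list ell2"
  show "0 \<le> dual_dist ?R x y"
    using pure_tensors_nonempty[of C k] upper by (meson abs_ge_zero all_not_in_conv order_trans)
  have "\<bar>inner r (x - y)\<bar> = \<bar>inner r (y - x)\<bar>" for r
    unfolding inner_diff_right by (rule abs_minus_commute)
  then show "dual_dist ?R x y = dual_dist ?R y x"
    by (simp only: dual_dist_def)
  show "dual_dist ?R x y = 0 \<longleftrightarrow> x = y" if "x \<in> sym_ball C k" "y \<in> sym_ball C k"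
  proof
    assume "x = y"
    then show "dual_dist ?R x y = 0"
      using pure_tensors_nonempty[of C k] by (simp add: dual_dist_def)
  next
    assume 0: "dual_dist ?R x y = 0"
    show "x = y"
    proof (rule ell2_eqI)
      fix cs
      show "ell2_at x cs = ell2_at y cs"
      proof (cases "cs \<in> tuples k C")
        case True
        then have "map ell2_delta cs \<in> tuples k (ell2_on C \<inter> cball 0 1)"
          by (auto simp: tuples_def ell2_on_def ell2_at_delta norm_delta)
        then have "ell2_delta cs \<in> ?R"
          unfolding pure_tensors_def by (metis tensor_delta image_eqI)
        from upper[OF this, of x y] 0 show ?thesis
          by (simp add: inner_delta minus_ell2.rep_eq)
      next
        case False
        then show ?thesis
          using that by (auto simp: sym_ball_def sym_tensor_space_def tensor_space_def ell2_on_def)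
      qed
    qed
  qed
  fix z
  show "dual_dist ?R x z \<le> dual_dist ?R x y + dual_dist ?R y z"
    unfolding dual_dist_def[of _ x z]
  proof (rule cSUP_least[OF pure_tensors_nonempty])
    fix r assume "r \<in> ?R"
    then show "\<bar>inner r (x - z)\<bar> \<le> dual_dist ?R x y + dual_dist ?R y z"
      using upper[of r x y] upper[of r y z] by (simp add: inner_diff_right)
  qed
qed

section \<open>The action of the orthogonal group\<close>

text \<open>Only the values on \<open>H\<close> matter; \<open>g\<close> is unconstrained outside \<open>ell2_on C\<close>.\<close>

definition orthogonal_group :: "'c set \<Rightarrow> ('c ell2 \<Rightarrow> 'c ell2) set" where
  "orthogonal_group C = {g.
     g ` ell2_on C = ell2_on C \<and>
     (\<forall>x\<in>ell2_on C. \<forall>y\<in>ell2_on C. g (x + y) = g x + g y) \<and>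
     (\<forall>a. \<forall>x\<in>ell2_on C. g (a *\<^sub>R x) = a *\<^sub>R g x) \<and>
     (\<forall>x\<in>ell2_on C. \<forall>y\<in>ell2_on C. inner (g x) (g y) = inner x y)}"

text \<open>\<open>T\<close> is the continuous linear extension of \<open>g\<^sup>\<otimes>\<^sup>k\<close> to \<open>H\<^sub>k\<close>, normalised outside \<open>H\<^sub>k\<close>.\<close>

definition is_tensor_power ::
    "'c set \<Rightarrow> nat \<Rightarrow> ('c ell2 \<Rightarrow> 'c ell2) \<Rightarrow> ('c list ell2 \<Rightarrow> 'c list ell2) \<Rightarrow> bool" where
  "is_tensor_power C k g T \<longleftrightarrow>
     T \<in> extensional (tensor_space C k) \<and>
     continuous_on (tensor_space C k) T \<and>
     (\<forall>x\<in>tensor_space C k. \<forall>y\<in>tensor_space C k. T (x + y) = T x + T y) \<and>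
     (\<forall>a. \<forall>x\<in>tensor_space C k. T (a *\<^sub>R x) = a *\<^sub>R T x) \<and>
     (\<forall>rs\<in>tuples k (ell2_on C). T (tensor rs) = tensor (map g rs))"

definition tensor_power ::
    "'c set \<Rightarrow> nat \<Rightarrow> ('c ell2 \<Rightarrow> 'c ell2) \<Rightarrow> 'c list ell2 \<Rightarrow> 'c list ell2" where
  "tensor_power C k g = (THE T. is_tensor_power C k g T)"

lemma isometry_extension:
  fixes p :: "'i \<Rightarrow> 'v::real_inner" and q :: "'i \<Rightarrow> 'w::{real_inner,complete_space}"
  assumes iso: "\<And>i j. i \<in> I \<Longrightarrow> j \<in> I \<Longrightarrow> inner (q i) (q j) = inner (p i) (p j)"
  obtains T where "continuous_on (closure (span (p ` I))) T"
    "\<And>x y. x \<in> closure (span (p ` I)) \<Longrightarrow> y \<in> closure (span (p ` I)) \<Longrightarrow> T (x + y) = T x + T y"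
    "\<And>a x. x \<in> closure (span (p ` I)) \<Longrightarrow> T (a *\<^sub>R x) = a *\<^sub>R T x"
    "\<And>i. i \<in> I \<Longrightarrow> T (p i) = q i"
proof -
  obtain B where B: "B \<subseteq> p ` I" "independent B" "p ` I \<subseteq> span B"
    using maximal_independent_subset[of "p ` I"] by blast
  define s where "s = inv_into I p"
  have s: "s b \<in> I" "p (s b) = b" if "b \<in> B" for b
    using that B(1) by (auto simp: s_def inv_into_into f_inv_into_f)
  obtain L where L: "linear L" "\<And>b. b \<in> B \<Longrightarrow> L b = q (s b)"
    using linear_independent_extend[OF B(2), of "\<lambda>b. q (s b)"] by blast
  have spanB: "span B = span (p ` I)"
    using B by (metis span_mono span_span subset_antisym span_minimal subspace_span)
  have 1: "inner (q i) (L y) = inner (p i) y" if "i \<in> I" "y \<in> span B" for i y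
    using that(2)
  proof (induction rule: span_induct)
    case base
    show ?case
      by (rule subspaceI) (auto simp: linear_0[OF L(1)] linear_add[OF L(1)] linear_scale[OF L(1)] inner_add_right)
  next
    case (step b)
    then show ?case using that(1) s[of b] L(2)[of b] iso[of i "s b"] by simp
  qed
  have 2: "inner (L x) (L y) = inner x y" if "x \<in> span B" "y \<in> span B" for x y
    using that(1)
  proof (induction rule: span_induct)
    case base
    show ?case
      by (rule subspaceI) (auto simp: linear_0[OF L(1)] linear_add[OF L(1)] linear_scale[OF L(1)] inner_add_left)
  next
    case (step b)
    then show ?case using that(2) s[of b] L(2)[of b] 1[of "s b" y] by simp
  qed
  have Lp: "L (p i) = q i" if "i \<in> I" for i
  proof -
    have p: "p i \<in> span B" using B(3) that by auto
    have "inner (L (p i) - q i) (L (p i) - q i) = 0"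
      using 1[OF that p] 2[OF p p] iso[OF that that]
      by (simp add: inner_diff_left inner_diff_right inner_commute[of "L (p i)" "q i"])
    then show ?thesis by simp
  qed
  have "dist (L x) (L y) = dist x y" if "x \<in> span B" "y \<in> span B" for x y
    using 2[OF span_diff span_diff, OF that that]
    by (simp add: dist_norm norm_eq_sqrt_inner linear_diff[OF L(1), symmetric])
  then have "uniformly_continuous_on (span B) L"
    by (auto simp: uniformly_continuous_on_def)
  then obtain T where T: "uniformly_continuous_on (closure (span B)) T"
    "\<And>x. x \<in> span B \<Longrightarrow> L x = T x"
    using uniformly_continuous_on_extension_on_closure by metis
  have contT: "continuous_on (closure (span B)) T"
    using T(1) by (rule uniformly_continuous_imp_continuous)
  have seq: "(\<lambda>n. L (u n)) \<longlonglongrightarrow> T x"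
    if "\<And>n. u n \<in> span B" "u \<longlonglongrightarrow> x" for u x
  proof -
    have "x \<in> closure (span B)" using that by (auto simp: closure_sequential)
    then have "(\<lambda>n. T (u n)) \<longlonglongrightarrow> T x"
      using contT that closure_subset[of "span B"]
      unfolding continuous_on_sequentially comp_def by blast
    then show ?thesis using that(1) T(2) by simp
  qed
  have add: "T (x + y) = T x + T y" if "x \<in> closure (span B)" "y \<in> closure (span B)" for x y
  proof -
    obtain u v where u: "\<And>n. u n \<in> span B" "u \<longlonglongrightarrow> x" and v: "\<And>n. v n \<in> span B" "v \<longlonglongrightarrow> y"
      using \<open>x \<in> closure (span B)\<close> \<open>y \<in> closure (span B)\<close> unfolding closure_sequential by blast
    have "(\<lambda>n. L (u n + v n)) \<longlonglongrightarrow> T (x + y)"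
      by (intro seq span_add u v tendsto_add)
    moreover have "(\<lambda>n. L (u n + v n)) \<longlonglongrightarrow> T x + T y"
      unfolding linear_add[OF L(1)] by (intro tendsto_add seq u v)
    ultimately show ?thesis by (rule LIMSEQ_unique)
  qed
  have scale: "T (a *\<^sub>R x) = a *\<^sub>R T x" if x: "x \<in> closure (span B)" for a x
  proof -
    obtain u where u: "\<And>n. u n \<in> span B" "u \<longlonglongrightarrow> x"
      using x unfolding closure_sequential by blast
    have "(\<lambda>n. L (a *\<^sub>R u n)) \<longlonglongrightarrow> T (a *\<^sub>R x)"
      by (intro seq span_scale u tendsto_scaleR tendsto_const)
    moreover have "(\<lambda>n. L (a *\<^sub>R u n)) \<longlonglongrightarrow> a *\<^sub>R T x"
      unfolding linear_scale[OF L(1)] by (intro tendsto_scaleR tendsto_const seq u)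
    ultimately show ?thesis by (rule LIMSEQ_unique)
  qed
  show thesis
  proof (rule that[of T, folded spanB, OF contT add scale])
    fix i assume "i \<in> I"
    then show "T (p i) = q i" using B(3) T(2)[of "p i"] Lp[of i] by auto
  qed
qed

lemma tensor_power_unique:
  assumes "is_tensor_power C k g S" "is_tensor_power C k g T"
  shows "S = T"
proof (rule extensionalityI)
  let ?P = "tensor ` tuples k (ell2_on C)"
  show "S \<in> extensional (tensor_space C k)" "T \<in> extensional (tensor_space C k)"
    using assms by (auto simp: is_tensor_power_def)
  have H: "subspace (tensor_space C k)"
    by (simp add: tensor_space_def subspace_ell2_on)
  have "subspace {x \<in> tensor_space C k. S x = T x}"
  proof (rule subspaceI)
    have "S (0 *\<^sub>R 0) = 0 *\<^sub>R S 0" "T (0 *\<^sub>R 0) = 0 *\<^sub>R T 0"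
      using assms subspace_0[OF H] unfolding is_tensor_power_def by blast+
    then show "0 \<in> {x \<in> tensor_space C k. S x = T x}"
      using subspace_0[OF H] by simp
  next
    fix x y assume "x \<in> {x \<in> tensor_space C k. S x = T x}" "y \<in> {x \<in> tensor_space C k. S x = T x}"
    then show "x + y \<in> {x \<in> tensor_space C k. S x = T x}"
      using assms subspace_add[OF H] unfolding is_tensor_power_def by simp
  next
    fix a x assume "x \<in> {x \<in> tensor_space C k. S x = T x}"
    then show "a *\<^sub>R x \<in> {x \<in> tensor_space C k. S x = T x}"
      using assms subspace_scale[OF H] unfolding is_tensor_power_def by simp
  qed
  moreover have "?P \<subseteq> {x \<in> tensor_space C k. S x = T x}"
    using assms tensor_in_tensor_space by (auto simp: is_tensor_power_def)
  ultimately have eq: "S x = T x" if "x \<in> span ?P" for x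
    using that span_minimal by blast
  fix x assume "x \<in> tensor_space C k"
  then have "x \<in> closure (span ?P)" by (simp add: tensor_space_closure_span)
  moreover have "continuous_on (closure (span ?P)) (\<lambda>x. S x - T x)"
    using assms unfolding is_tensor_power_def tensor_space_closure_span
    by (intro continuous_on_diff) auto
  moreover have "S x - T x = 0" if "x \<in> span ?P" for x
    using eq[OF that] by simp
  ultimately have "S x - T x = 0"
    by (rule continuous_constant_on_closure[rotated 2])
  then show "S x = T x" by simp
qed

lemma is_tensor_power_tensor_power:
  assumes "g \<in> orthogonal_group C"
  shows "is_tensor_power C k g (tensor_power C k g)"
proof -
  let ?I = "tuples k (ell2_on C)"
  have "inner (tensor (map g rs)) (tensor (map g ss)) = inner (tensor rs) (tensor ss)"
    if "rs \<in> ?I" "ss \<in> ?I" for rs ss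
  proof -
    have "inner (g (rs ! i)) (g (ss ! i)) = inner (rs ! i) (ss ! i)" if "i < k" for i
      using assms \<open>rs \<in> ?I\<close> \<open>ss \<in> ?I\<close> that unfolding orthogonal_group_def tuples_def
      by (auto dest!: subsetD[OF _ nth_mem])
    then show ?thesis using that by (simp add: tuples_def inner_tensor)
  qed
  then obtain T where T: "continuous_on (closure (span (tensor ` ?I))) T"
    "\<And>x y. x \<in> closure (span (tensor ` ?I)) \<Longrightarrow> y \<in> closure (span (tensor ` ?I)) \<Longrightarrow>
      T (x + y) = T x + T y"
    "\<And>a x. x \<in> closure (span (tensor ` ?I)) \<Longrightarrow> T (a *\<^sub>R x) = a *\<^sub>R T x"
    "\<And>rs. rs \<in> ?I \<Longrightarrow> T (tensor rs) = tensor (map g rs)"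
    using isometry_extension[of ?I "\<lambda>rs. tensor (map g rs)" tensor] by blast
  note T = T[folded tensor_space_closure_span]
  have sub: "subspace (tensor_space C k)" by (simp add: tensor_space_def subspace_ell2_on)
  have "is_tensor_power C k g (restrict T (tensor_space C k))"
    unfolding is_tensor_power_def
    using T by (auto simp: subspace_add[OF sub] subspace_scale[OF sub] tensor_in_tensor_space
        cong: continuous_on_cong)
  then show ?thesis
    unfolding tensor_power_def using tensor_power_unique by (metis theI)
qed

definition orbit :: "'c set \<Rightarrow> (nat \<Rightarrow> 'c list ell2) \<Rightarrow> (nat \<Rightarrow> 'c list ell2) set" where
  "orbit C x = {\<lambda>k. tensor_power C k g (x k) | g. g \<in> orthogonal_group C}"

section \<open>Quotient topology\<close>

definition quotient_topology :: "'a topology \<Rightarrow> ('a \<Rightarrow> 'b) \<Rightarrow> 'b topology" where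
  "quotient_topology X f =
     topology (\<lambda>U. U \<subseteq> f ` topspace X \<and> openin X {x \<in> topspace X. f x \<in> U})"

lemma openin_quotient_topology:
  "openin (quotient_topology X f) U \<longleftrightarrow>
     U \<subseteq> f ` topspace X \<and> openin X {x \<in> topspace X. f x \<in> U}"
proof -
  have "istopology (\<lambda>U. U \<subseteq> f ` topspace X \<and> openin X {x \<in> topspace X. f x \<in> U})"
    unfolding istopology_def
  proof (rule conjI; intro allI impI; (elim conjE)?)
    fix S T
    assume "S \<subseteq> f ` topspace X" and "openin X {x \<in> topspace X. f x \<in> S}" "openin X {x \<in> topspace X. f x \<in> T}"
    then have "openin X ({x \<in> topspace X. f x \<in> S} \<inter> {x \<in> topspace X. f x \<in> T})" by blast
    also have "{x \<in> topspace X. f x \<in> S} \<inter> {x \<in> topspace X. f x \<in> T} =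
        {x \<in> topspace X. f x \<in> S \<inter> T}" by auto
    finally show "S \<inter> T \<subseteq> f ` topspace X \<and> openin X {x \<in> topspace X. f x \<in> S \<inter> T}"
      using \<open>S \<subseteq> f ` topspace X\<close> by auto
  next
    fix \<K>
    assume *: "\<forall>U\<in>\<K>. U \<subseteq> f ` topspace X \<and> openin X {x \<in> topspace X. f x \<in> U}"
    have "openin X (\<Union>U\<in>\<K>. {x \<in> topspace X. f x \<in> U})" using * by blast
    also have "(\<Union>U\<in>\<K>. {x \<in> topspace X. f x \<in> U}) = {x \<in> topspace X. f x \<in> \<Union>\<K>}" by auto
    finally show "\<Union>\<K> \<subseteq> f ` topspace X \<and> openin X {x \<in> topspace X. f x \<in> \<Union>\<K>}"
      using * by blast
  qed
  then show ?thesis by (simp add: quotient_topology_def)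
qed

lemma topspace_quotient_topology: "topspace (quotient_topology X f) = f ` topspace X"
proof
  show "topspace (quotient_topology X f) \<subseteq> f ` topspace X"
    using openin_quotient_topology[of X f] openin_topspace by blast
  have "{x \<in> topspace X. f x \<in> f ` topspace X} = topspace X" by auto
  then have "openin (quotient_topology X f) (f ` topspace X)"
    by (simp add: openin_quotient_topology)
  then show "f ` topspace X \<subseteq> topspace (quotient_topology X f)" by (rule openin_subset)
qed

lemma quotient_map_quotient_topology: "quotient_map X (quotient_topology X f) f"
  by (simp add: quotient_map_def topspace_quotient_topology openin_quotient_topology)

end

theory Submission
  imports Defs
begin

text \<open>Compactness of the quotient of a countable product of complete metric spaces by a group of
  coordinatewise isometries follows once the product is totally bounded modulo the group. Completeness
  of \<open>(B\<^sub>k, d\<^sub>R)\<close> holds because a Cauchy sequence converges pointwise, hence weakly.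
  Total boundedness modulo \<open>O(H)\<close> is a weak regularity lemma: fix an increasing chain of
  finite subsets \<open>D\<^sub>i\<close> of \<open>C\<close>. If a point is not \<open>\<epsilon>\<close>-close in
  \<open>d\<^sub>R\<close> to its restriction to \<open>D\<^sub>i\<close>, then a rotation fixing
  \<open>\<ell>\<^sup>2(D\<^sub>i)\<close> makes its restriction to the next set gain \<open>\<epsilon>\<^sup>2\<close> in squared
  norm. The norms are at most 1, so after a bounded number of rotations the point is close
  to a bounded vector in a fixed finite-dimensional space.\<close>

section \<open>Quotients of products by isometries\<close>

text \<open>For infinite \<open>C\<close> the rotations carry the whole difficulty: in degree 1 the
  metric \<open>d\<^sub>R\<close> is the norm metric of a Hilbert ball, which is not totally
  bounded. The sets D_i are chosen before the point. In the usual weak regularity lemma the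
  approximating structure is adapted to the point; here the point is rotated until a fixed
  coordinate subspace serves. A witness in \<open>R\<^sub>k\<close> has only k factors, so k new
  coordinates are enough to hold it. One rotation acts in all degrees at once. Squared norms are
  therefore added up over the degrees k \<le> n, with total at most n + 1, and no degree loses what
  it has gained. Total boundedness modulo the group gives closeness only after moving a point in its
  orbit. Since the action is isometric, the centre can be moved instead; successive centres are then
  close in the product itself, where completeness applies. The single index of \<open>near\<close>
  governs both the number of coordinates and the radius, so one sequence controls the whole
  product.\<close>

definition near :: "(nat \<Rightarrow> 'a \<Rightarrow> 'a \<Rightarrow> real) \<Rightarrow> nat \<Rightarrow> (nat \<Rightarrow> 'a) \<Rightarrow> (nat \<Rightarrow> 'a) \<Rightarrow> bool" where
  "near d n x y \<longleftrightarrow> (\<forall>k\<le>n. d k (x k) (y k) \<le> (1/2) ^ n)"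

lemma product_metric_limit:
  fixes M :: "nat \<Rightarrow> 'a set"
  assumes ms: "\<And>k. Metric_space (M k) (d k)"
    and complete: "\<And>k. Metric_space.mcomplete (M k) (d k)"
    and z: "\<And>n. z n \<in> Pi\<^sub>E UNIV M"
    and step: "\<And>n k. k \<le> n \<Longrightarrow> d k (z n k) (z (Suc n) k) \<le> 2 * (1/2) ^ n"
  obtains l where "l \<in> Pi\<^sub>E UNIV M"
    "\<And>k e. 0 < e \<Longrightarrow> \<forall>\<^sub>F n in sequentially. d k (z n k) (l k) < e"
proof -
  have zM: "z n k \<in> M k" for n k using z[of n] by auto
  have "\<exists>l. limitin (Metric_space.mtopology (M k) (d k)) (\<lambda>n. z n k) l sequentially" for k
  proof -
    interpret Metric_space "M k" "d k" by (rule ms)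
    \<comment> \<open>The right-hand side is the geometric sum of the steps
      \<open>2 * (1/2) ^ i\<close> for m \<le> i < m + j; the subtracted tail lets the induction
      close.\<close>
    have bound: "d k (z m k) (z (m + j) k) \<le> 4 * (1/2) ^ m - 4 * (1/2) ^ (m + j)" if "k \<le> m" for m j
    proof (induction j)
      case 0
      then show ?case using zM by simp
    next
      case (Suc j)
      have "d k (z m k) (z (m + Suc j) k) \<le> d k (z m k) (z (m + j) k) + d k (z (m + j) k) (z (Suc (m + j)) k)"
        using triangle zM by simp
      with Suc step[of k "m + j"] that show ?case by simp
    qed
    have "MCauchy (\<lambda>n. z n k)"
      unfolding MCauchy_def
    proof (intro conjI allI impI)
      show "range (\<lambda>n. z n k) \<subseteq> M k" using zM by auto
      fix e :: real assume "0 < e"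
      \<comment> \<open>Two points are compared through the N-th one, each at distance at most
        \<open>4 * (1/2) ^ N\<close>; hence the 8.\<close>
      then obtain N0 where N0: "(1/2 :: real) ^ N0 < e / 8"
        using real_arch_pow_inv[of "e / 8" "1/2"] by auto
      \<comment> \<open>The steps control coordinate \<open>k\<close> only from index
        \<open>k\<close> on.\<close>
      define N where "N = max N0 k"
      have "(1/2 :: real) ^ N \<le> (1/2) ^ N0"
        by (rule power_decreasing) (auto simp: N_def)
      with N0 have N: "8 * (1/2 :: real) ^ N < e" by linarith
      have *: "d k (z N k) (z n k) \<le> 4 * (1/2) ^ N" if n: "N \<le> n" for n
      proof -
        obtain j where j: "n = N + j" using n le_Suc_ex by blast
        have "0 \<le> 4 * (1/2 :: real) ^ (N + j)" by simp
        with bound[of N j] show ?thesis unfolding j N_def by linarith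
      qed
      show "\<exists>N. \<forall>n n'. N \<le> n \<longrightarrow> N \<le> n' \<longrightarrow> d k (z n k) (z n' k) < e"
      proof (intro exI[of _ N] allI impI)
        fix n n' assume "N \<le> n" "N \<le> n'"
        then show "d k (z n k) (z n' k) < e"
          using *[of n] *[of n'] N triangle[of "z n k" "z N k" "z n' k"] zM commute[of "z n k" "z N k"]
          by simp
      qed
    qed
    then show ?thesis using complete[of k] unfolding mcomplete_def by blast
  qed
  then obtain l where l: "\<And>k. limitin (Metric_space.mtopology (M k) (d k)) (\<lambda>n. z n k) (l k) sequentially"
    by metis
  show thesis
  proof
    show "l \<in> Pi\<^sub>E UNIV M" using l by (auto simp: Metric_space.limitin_metric[OF ms])
    show "\<forall>\<^sub>F n in sequentially. d k (z n k) (l k) < e" if "0 < e" for k e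
      using l[of k] that by (auto simp: Metric_space.limitin_metric[OF ms] elim: eventually_mono)
  qed
qed

text \<open>A basic open box around \<open>l\<close> restricts only finitely many coordinates. For
  large \<open>n\<close> all of these have index at most \<open>n\<close>, and there
  \<open>z n\<close> is within half the radius of \<open>l\<close> while \<open>(1/2) ^ n\<close> is
  below the other half.\<close>

lemma openin_product_metric_contains_near:
  fixes M :: "nat \<Rightarrow> 'a set"
  assumes ms: "\<And>k. Metric_space (M k) (d k)"
    and U: "openin (product_topology (\<lambda>k. Metric_space.mtopology (M k) (d k)) UNIV) U" "l \<in> U"
    and z: "\<And>n. z n \<in> Pi\<^sub>E UNIV M" and l: "l \<in> Pi\<^sub>E UNIV M"
    and lim: "\<And>k e. 0 < e \<Longrightarrow> \<forall>\<^sub>F n in sequentially. d k (z n k) (l k) < e"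
  obtains n where "\<And>x. x \<in> Pi\<^sub>E UNIV M \<Longrightarrow> near d n (z n) x \<Longrightarrow> x \<in> U"
proof -
  obtain V where V: "finite {i. V i \<noteq> M i}" "\<And>i. openin (Metric_space.mtopology (M i) (d i)) (V i)"
    "l \<in> Pi\<^sub>E UNIV V" "Pi\<^sub>E UNIV V \<subseteq> U"
    using U unfolding openin_product_topology_alt by (auto simp: Metric_space.topspace_mtopology[OF ms])
  have "\<exists>r>0. Metric_space.mball (M i) (d i) (l i) r \<subseteq> V i" for i
    using V(2)[of i] V(3) by (auto simp: Metric_space.openin_mtopology[OF ms])
  then obtain r where r: "\<And>i. r i > 0" "\<And>i. Metric_space.mball (M i) (d i) (l i) (r i) \<subseteq> V i"
    by metis
  let ?I = "{i. V i \<noteq> M i}"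
  have "\<forall>\<^sub>F n in sequentially. \<forall>i\<in>?I. d i (z n i) (l i) < r i / 2"
    by (intro eventually_ball_finite V(1) ballI lim half_gt_zero r(1))
  moreover have "\<forall>\<^sub>F n in sequentially. \<forall>i\<in>?I. i \<le> n"
    using V(1) by (intro eventually_ball_finite ballI eventually_ge_at_top)
  moreover have "\<forall>\<^sub>F n in sequentially. \<forall>i\<in>?I. (1/2 :: real) ^ n < r i / 2"
  proof (intro eventually_ball_finite V(1) ballI)
    fix i
    have "(\<lambda>n. (1/2 :: real) ^ n) \<longlonglongrightarrow> 0" by (rule LIMSEQ_power_zero) simp
    then show "\<forall>\<^sub>F n in sequentially. (1/2 :: real) ^ n < r i / 2"
      by (rule order_tendstoD) (use r(1)[of i] in simp)
  qed
  ultimately have "\<forall>\<^sub>F n in sequentially. \<forall>i\<in>?I. d i (z n i) (l i) < r i / 2 \<and> i \<le> n \<and> (1/2 :: real) ^ n < r i / 2"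
    by eventually_elim auto
  then obtain n where n: "\<And>i. i \<in> ?I \<Longrightarrow> d i (z n i) (l i) < r i / 2 \<and> i \<le> n \<and> (1/2 :: real) ^ n < r i / 2"
    using eventually_happens'[OF sequentially_bot] by blast
  show thesis
  proof
    fix x assume x: "x \<in> Pi\<^sub>E UNIV M" "near d n (z n) x"
    have "x i \<in> V i" for i
    proof (cases "V i = M i")
      case True
      then show ?thesis using x by auto
    next
      case False
      interpret Metric_space "M i" "d i" by (rule ms)
      have mem: "x i \<in> M i" "l i \<in> M i" "z n i \<in> M i" using x z[of n] l by auto
      have "d i (l i) (x i) \<le> d i (z n i) (l i) + d i (z n i) (x i)"
        using triangle[of "l i" "z n i" "x i"] mem commute by metis
      also have "\<dots> < r i" using n[of i] False x(2) by (force simp: near_def)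
      finally show ?thesis using r(2)[of i] mem by auto
    qed
    then show "x \<in> U" using V(4) by auto
  qed
qed

text \<open>Bisection: a cover without finite subcover yields points \<open>z\<^sub>n\<close>, moved along their orbits so as
  to form a Cauchy sequence, with shrinking neighbourhoods that are not finitely covered either.\<close>

lemma compact_space_quotient_of_isometric_product:
  fixes M :: "nat \<Rightarrow> 'a set" and q :: "(nat \<Rightarrow> 'a) \<Rightarrow> 'b"
  defines "X \<equiv> Pi\<^sub>E UNIV M"
  assumes ms: "\<And>k. Metric_space (M k) (d k)"
    and complete: "\<And>k. Metric_space.mcomplete (M k) (d k)"
    and homogeneous: "\<And>x y. x \<in> X \<Longrightarrow> y \<in> X \<Longrightarrow> q x = q y \<Longrightarrow>
      \<exists>\<phi>. \<phi> \<in> X \<rightarrow> X \<and> \<phi> y = x \<and> (\<forall>w\<in>X. q (\<phi> w) = q w) \<and>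
        (\<forall>k. \<forall>v\<in>X. \<forall>w\<in>X. d k (\<phi> v k) (\<phi> w k) = d k (v k) (w k))"
    and bounded: "\<And>n. \<exists>Z. finite Z \<and> Z \<subseteq> X \<and> (\<forall>x\<in>X. \<exists>y\<in>X. \<exists>z\<in>Z. q y = q x \<and> near d n z y)"
  shows "compact_space
    (quotient_topology (product_topology (\<lambda>k. Metric_space.mtopology (M k) (d k)) UNIV) q)"
proof -
  let ?P = "product_topology (\<lambda>k. Metric_space.mtopology (M k) (d k)) UNIV"
  have top: "topspace ?P = X"
    by (simp add: X_def Metric_space.topspace_mtopology[OF ms])
  show ?thesis
    unfolding compact_space_alt topspace_quotient_topology top
  proof (intro allI impI, elim conjE)
    fix \<U> assume op: "\<forall>U\<in>\<U>. openin (quotient_topology ?P q) U" and cov: "q ` X \<subseteq> \<Union>\<U>"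
    \<comment> \<open>Smallness depends only on the image under \<open>q\<close>, so it survives
      replacing points by others of the same class.\<close>
    define small where "small S \<longleftrightarrow> (\<exists>\<F>. finite \<F> \<and> \<F> \<subseteq> \<U> \<and> q ` S \<subseteq> \<Union>\<F>)" for S
    have small_mono: "small T" if "small S" "q ` T \<subseteq> q ` S" for S T
      using that unfolding small_def by (meson order_trans)
    have small_UN: "small (\<Union>z\<in>Z. S z)" if Z: "finite Z" "\<And>z. z \<in> Z \<Longrightarrow> small (S z)" for Z :: "(nat \<Rightarrow> 'a) set" and S
    proof -
      obtain F where F: "\<And>z. z \<in> Z \<Longrightarrow> finite (F z) \<and> F z \<subseteq> \<U> \<and> q ` S z \<subseteq> \<Union>(F z)"
        using Z(2) unfolding small_def by metis
      show ?thesis unfolding small_def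
      proof (intro exI conjI)
        show "finite (\<Union>z\<in>Z. F z)" using Z(1) F by blast
        show "(\<Union>z\<in>Z. F z) \<subseteq> \<U>" using F by blast
        show "q ` (\<Union>z\<in>Z. S z) \<subseteq> \<Union> (\<Union>z\<in>Z. F z)"
        proof clarify
          fix z x assume "z \<in> Z" "x \<in> S z"
          then show "q x \<in> \<Union> (\<Union>z\<in>Z. F z)" using F[of z] by blast
        qed
      qed
    qed
    define B where "B n z = {x \<in> X. near d n z x}" for n z
    have "small X"
    proof (rule ccontr)
      assume notX: "\<not> small X"
      have refine: "\<exists>z\<in>X. \<not> small (B n z) \<and> (\<exists>x\<in>S. near d n x z)"
        if S: "\<not> small S" "S \<subseteq> X" for S n
      proof -
        obtain Z where Z: "finite Z" "Z \<subseteq> X" "\<And>x. x \<in> X \<Longrightarrow> \<exists>y\<in>X. \<exists>z\<in>Z. q y = q x \<and> near d n z y"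
          using bounded by metis
        \<comment> \<open>Closeness to the net holds only modulo \<open>q\<close>, so
          \<open>S\<close> is cut according to the balls that the classes of its points
          meet.\<close>
        have "S \<subseteq> (\<Union>z\<in>Z. {x \<in> S. \<exists>y\<in>B n z. q y = q x})"
          using S(2) Z(3) by (fastforce simp: B_def)
        then have "\<not> small (\<Union>z\<in>Z. {x \<in> S. \<exists>y\<in>B n z. q y = q x})"
          using S(1) small_mono by (meson image_mono)
        then have "\<exists>z\<in>Z. \<not> small {x \<in> S. \<exists>y\<in>B n z. q y = q x}"
          by (rule contrapos_np) (rule small_UN[OF Z(1)], simp)
        then obtain z where z: "z \<in> Z" "\<not> small {x \<in> S. \<exists>y\<in>B n z. q y = q x}" ..
        \<comment> \<open>A piece that is not small is nonempty; this provides a point of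
          \<open>S\<close> next to which the centre can be moved.\<close>
        have "small {}" unfolding small_def by (rule exI[of _ "{}"]) simp
        with z(2) have "{x \<in> S. \<exists>y\<in>B n z. q y = q x} \<noteq> {}" by metis
        then obtain x y where x: "x \<in> S" and y: "y \<in> B n z" "q y = q x" by blast
        have yX: "y \<in> X" using y by (simp add: B_def)
        have zX: "z \<in> X" using z Z by blast
        have "x \<in> X" using x S(2) by blast
        \<comment> \<open>\<open>\<phi>\<close> takes \<open>y\<close> back to \<open>x\<close>,
          hence the centre \<open>z\<close> to a point near \<open>x\<close>. The ball around
          \<open>\<phi> z\<close> still meets all classes of the piece, so it is not small
          either.\<close>
        from homogeneous[OF this yX y(2)[symmetric]] obtain \<phi> where \<phi>: "\<phi> \<in> X \<rightarrow> X" "\<phi> y = x"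
          "\<And>w. w \<in> X \<Longrightarrow> q (\<phi> w) = q w"
          "\<And>k v w. v \<in> X \<Longrightarrow> w \<in> X \<Longrightarrow> d k (\<phi> v k) (\<phi> w k) = d k (v k) (w k)"
          by blast
        have "\<not> small (B n (\<phi> z))"
        proof
          assume "small (B n (\<phi> z))"
          moreover have "q ` {x \<in> S. \<exists>y\<in>B n z. q y = q x} \<subseteq> q ` B n (\<phi> z)"
          proof clarify
            fix u w assume "w \<in> B n z" "q w = q u"
            then have "\<phi> w \<in> B n (\<phi> z)" "q (\<phi> w) = q u"
              using \<phi> zX by (auto simp: B_def near_def)
            then show "q u \<in> q ` B n (\<phi> z)" by (metis imageI)
          qed
          ultimately show False using z(2) small_mono by blast
        qed
        moreover have "near d n x (\<phi> z)"
        proof -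
          have "d k (x k) (\<phi> z k) = d k (z k) (y k)" for k
          proof -
            have "y k \<in> M k" "z k \<in> M k" using yX zX by (auto simp: X_def)
            then show ?thesis
              using \<phi>(4)[OF yX zX] unfolding \<phi>(2) by (simp add: Metric_space.commute[OF ms])
          qed
          then show ?thesis using y(1) by (simp add: B_def near_def)
        qed
        ultimately show ?thesis using \<phi>(1) zX x by blast
      qed
      define Q where "Q n z \<longleftrightarrow> z \<in> X \<and> \<not> small (B n z)" for n z
      have "\<exists>z. Q 0 z" using refine[OF notX subset_refl] by (auto simp: Q_def)
      moreover have "\<exists>z'. Q (Suc n) z' \<and> (\<forall>k\<le>n. d k (z k) (z' k) \<le> 2 * (1/2) ^ n)" if "Q n z" for z n
      proof -
        from refine[of "B n z" "Suc n"] that obtain z' x where z': "z' \<in> X" "\<not> small (B (Suc n) z')"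
          and x: "x \<in> B n z" "near d (Suc n) x z'"
          by (auto simp: Q_def B_def)
        have "d k (z k) (z' k) \<le> 2 * (1/2) ^ n" if "k \<le> n" for k
        proof -
          have mem: "z k \<in> M k" "x k \<in> M k" "z' k \<in> M k"
            using \<open>Q n z\<close> x z' by (auto simp: Q_def B_def X_def)
          have "d k (z k) (z' k) \<le> d k (z k) (x k) + d k (x k) (z' k)"
            using Metric_space.triangle[OF ms mem] .
          also have "\<dots> \<le> (1/2) ^ n + (1/2) ^ Suc n"
            using x that by (intro add_mono) (auto simp: B_def near_def)
          also have "\<dots> \<le> 2 * (1/2) ^ n" by simp
          finally show ?thesis .
        qed
        with z' show ?thesis by (auto simp: Q_def)
      qed
      ultimately obtain z where z: "\<And>n. Q n (z n)"
        "\<And>n. \<forall>k\<le>n. d k (z n k) (z (Suc n) k) \<le> 2 * (1/2) ^ n"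
        using dependent_nat_choice[of Q "\<lambda>n z z'. \<forall>k\<le>n. d k (z k) (z' k) \<le> 2 * (1/2) ^ n"] by metis
      have zX: "z n \<in> Pi\<^sub>E UNIV M" for n using z(1)[of n] by (simp add: Q_def X_def)
      obtain l where l: "l \<in> Pi\<^sub>E UNIV M" "\<And>k e. 0 < e \<Longrightarrow> \<forall>\<^sub>F n in sequentially. d k (z n k) (l k) < e"
        using product_metric_limit[of M d z, OF ms complete zX] z(2) by blast
      then have "q l \<in> \<Union>\<U>" using cov unfolding X_def by blast
      then obtain U where U: "U \<in> \<U>" "q l \<in> U" by blast
      have opU: "openin ?P {x \<in> X. q x \<in> U}"
        using op U(1) unfolding openin_quotient_topology top by blast
      have "l \<in> {x \<in> X. q x \<in> U}" using l U by (simp add: X_def)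
      then obtain n where n: "\<And>x. x \<in> Pi\<^sub>E UNIV M \<Longrightarrow> near d n (z n) x \<Longrightarrow> x \<in> {x \<in> X. q x \<in> U}"
        using openin_product_metric_contains_near[OF ms opU _ zX l] by blast
      \<comment> \<open>A single member of the cover suffices for this ball, against the choice of
        \<open>z n\<close>.\<close>
      then have "q ` B n (z n) \<subseteq> \<Union>{U}" by (auto simp: B_def X_def)
      then have "small (B n (z n))" unfolding small_def using U(1) by blast
      then show False using z(1)[of n] by (simp add: Q_def)
    qed
    then show "\<exists>\<F>. finite \<F> \<and> \<F> \<subseteq> \<U> \<and> q ` X \<subseteq> \<Union>\<F>" by (simp add: small_def)
  qed
qed

section \<open>Tensor powers of orthogonal maps\<close>

lemma subspace_tensor_space: "subspace (tensor_space C k)"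
  by (simp add: tensor_space_def subspace_ell2_on)

lemma closed_tensor_space: "closed (tensor_space C k)"
  by (simp add: tensor_space_def closed_ell2_on)

text \<open>Pure tensors span a dense subspace, so a property closed under linear operations and
  limits need only be checked on them. Zero requires no case of its own: it is a pure tensor scaled
  by 0.\<close>

lemma tensor_space_induct [consumes 1, case_names tensor add scale limit]:
  assumes x: "x \<in> tensor_space C k"
    and tensor: "\<And>rs. rs \<in> tuples k (ell2_on C) \<Longrightarrow> P (tensor rs)"
    and add: "\<And>x y. x \<in> tensor_space C k \<Longrightarrow> y \<in> tensor_space C k \<Longrightarrow> P x \<Longrightarrow> P y \<Longrightarrow> P (x + y)"
    and scale: "\<And>a x. x \<in> tensor_space C k \<Longrightarrow> P x \<Longrightarrow> P (a *\<^sub>R x)"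
    and limit: "\<And>u x. (\<And>n. u n \<in> tensor_space C k) \<Longrightarrow> x \<in> tensor_space C k \<Longrightarrow>
      (\<And>n. P (u n)) \<Longrightarrow> u \<longlonglongrightarrow> x \<Longrightarrow> P x"
  shows "P x"
proof -
  let ?S = "{x \<in> tensor_space C k. P x}"
  have rep: "replicate k 0 \<in> tuples k (ell2_on C)"
    by (auto simp: tuples_def subspace_0[OF subspace_ell2_on])
  have "P (0 *\<^sub>R tensor (replicate k 0))"
    by (intro scale tensor tensor_in_tensor_space rep)
  then have "subspace ?S"
    by (intro subspaceI) (auto simp: add scale subspace_0[OF subspace_tensor_space]
        subspace_add[OF subspace_tensor_space] subspace_scale[OF subspace_tensor_space])
  moreover have "tensor ` tuples k (ell2_on C) \<subseteq> ?S"
    by (auto simp: tensor tensor_in_tensor_space)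
  ultimately have span: "span (tensor ` tuples k (ell2_on C)) \<subseteq> ?S"
    by (rule span_minimal[rotated])
  obtain u where u: "\<And>n. u n \<in> span (tensor ` tuples k (ell2_on C))" "u \<longlonglongrightarrow> x"
    using x unfolding tensor_space_closure_span closure_sequential by blast
  from u(1) span have "u n \<in> tensor_space C k" "P (u n)" for n by blast+
  with x u(2) show "P x" using limit by blast
qed

section \<open>Composition and inverses of orthogonal maps\<close>

lemma orthogonal_group_iff:
  "g \<in> orthogonal_group C \<longleftrightarrow> g ` ell2_on C = ell2_on C \<and>
    (\<forall>x\<in>ell2_on C. \<forall>y\<in>ell2_on C. g (x + y) = g x + g y) \<and>
    (\<forall>a. \<forall>x\<in>ell2_on C. g (a *\<^sub>R x) = a *\<^sub>R g x) \<and>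
    (\<forall>x\<in>ell2_on C. \<forall>y\<in>ell2_on C. inner (g x) (g y) = inner x y)"
  unfolding orthogonal_group_def by (rule mem_Collect_eq)

lemma orthogonal_comp:
  assumes "g \<in> orthogonal_group C" "h \<in> orthogonal_group C"
  shows "g \<circ> h \<in> orthogonal_group C"
  unfolding orthogonal_group_iff
proof (intro conjI ballI allI)
  have h: "h x \<in> ell2_on C" if "x \<in> ell2_on C" for x
    using assms(2) that unfolding orthogonal_group_iff by blast
  show "(g \<circ> h) ` ell2_on C = ell2_on C"
    using assms unfolding orthogonal_group_iff image_comp[symmetric] by metis
  fix x y assume xy: "x \<in> ell2_on C" "y \<in> ell2_on C"
  show "(g \<circ> h) (x + y) = (g \<circ> h) x + (g \<circ> h) y"
    "inner ((g \<circ> h) x) ((g \<circ> h) y) = inner x y"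
    using assms xy h unfolding orthogonal_group_iff comp_def by metis+
next
  fix a x assume "x \<in> ell2_on C"
  then show "(g \<circ> h) (a *\<^sub>R x) = a *\<^sub>R (g \<circ> h) x"
    using assms unfolding orthogonal_group_iff comp_def by (metis image_eqI)
qed

text \<open>Preserving inner products makes \<open>g\<close> injective on \<open>ell2_on C\<close>.
  Outside that subspace \<open>g\<close> is arbitrary, so the inverse is taken and asserted only on
  it.\<close>

lemma orthogonal_inverse:
  assumes g: "g \<in> orthogonal_group C"
  obtains h where "h \<in> orthogonal_group C" "\<And>x. x \<in> ell2_on C \<Longrightarrow> g (h x) = x"
    "\<And>x. x \<in> ell2_on C \<Longrightarrow> h (g x) = x"
proof -
  let ?H = "ell2_on C"
  have im: "g ` ?H = ?H"
    and add: "\<And>x y. x \<in> ?H \<Longrightarrow> y \<in> ?H \<Longrightarrow> g (x + y) = g x + g y"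
    and scale: "\<And>a x. x \<in> ?H \<Longrightarrow> g (a *\<^sub>R x) = a *\<^sub>R g x"
    and inner: "\<And>x y. x \<in> ?H \<Longrightarrow> y \<in> ?H \<Longrightarrow> inner (g x) (g y) = inner x y"
    using g unfolding orthogonal_group_iff by blast+
  have inj: "inj_on g ?H"
  proof (rule inj_onI)
    fix x y assume xy: "x \<in> ?H" "y \<in> ?H" "g x = g y"
    have "inner (x - y) (x - y) = inner (g x) (g x) - 2 * inner (g x) (g y) + inner (g y) (g y)"
      using xy(1,2) by (simp only: inner) (simp add: inner_diff_left inner_diff_right inner_commute[of y x])
    also have "\<dots> = 0" using xy(3) by simp
    finally show "x = y" by simp
  qed
  define h where "h = inv_into ?H g"
  have h: "h x \<in> ?H" "g (h x) = x" if "x \<in> ?H" for x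
    using that im unfolding h_def by (metis inv_into_into, metis f_inv_into_f)
  have hg: "h (g x) = x" if "x \<in> ?H" for x
    unfolding h_def using inj that by (rule inv_into_f_f)
  have "h \<in> orthogonal_group C"
    unfolding orthogonal_group_iff
  proof (intro conjI ballI allI)
    show "h ` ?H = ?H" using h(1) hg im by (metis (no_types, lifting) image_eqI image_subset_iff subsetI subset_antisym)
    fix x y assume xy: "x \<in> ?H" "y \<in> ?H"
    show "h (x + y) = h x + h y"
      using hg[of "h x + h y"] h xy add[of "h x" "h y"] subspace_add[OF subspace_ell2_on] by metis
    show "inner (h x) (h y) = inner x y"
      using inner[of "h x" "h y"] h xy by simp
  next
    fix a x assume x: "x \<in> ?H"
    show "h (a *\<^sub>R x) = a *\<^sub>R h x"
      using hg[of "a *\<^sub>R h x"] h x scale[of "h x"] subspace_scale[OF subspace_ell2_on] by metis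
  qed
  with h hg that show thesis by blast
qed

section \<open>Isometric action on the tensor spaces\<close>

context
  fixes C :: "'c set" and g
  assumes g: "g \<in> orthogonal_group C"
begin

lemma orthogonal_in: "x \<in> ell2_on C \<Longrightarrow> g x \<in> ell2_on C"
  using g unfolding orthogonal_group_iff by blast

lemma inner_orthogonal: "x \<in> ell2_on C \<Longrightarrow> y \<in> ell2_on C \<Longrightarrow> inner (g x) (g y) = inner x y"
  using g unfolding orthogonal_group_iff by blast

lemma norm_orthogonal: "x \<in> ell2_on C \<Longrightarrow> norm (g x) = norm x"
  by (simp add: norm_eq_sqrt_inner inner_orthogonal)

lemma map_orthogonal_tuples: "rs \<in> tuples k (ell2_on C) \<Longrightarrow> map g rs \<in> tuples k (ell2_on C)"
  using orthogonal_in by (auto simp: tuples_def)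

lemma tensor_power_tensor:
  "rs \<in> tuples k (ell2_on C) \<Longrightarrow> tensor_power C k g (tensor rs) = tensor (map g rs)"
  using is_tensor_power_tensor_power[OF g] unfolding is_tensor_power_def by blast

lemma tensor_power_add:
  "x \<in> tensor_space C k \<Longrightarrow> y \<in> tensor_space C k \<Longrightarrow>
    tensor_power C k g (x + y) = tensor_power C k g x + tensor_power C k g y"
  using is_tensor_power_tensor_power[OF g] unfolding is_tensor_power_def by blast

lemma tensor_power_scale:
  "x \<in> tensor_space C k \<Longrightarrow> tensor_power C k g (a *\<^sub>R x) = a *\<^sub>R tensor_power C k g x"
  using is_tensor_power_tensor_power[OF g] unfolding is_tensor_power_def by blast

lemma tensor_power_diff:
  assumes "x \<in> tensor_space C k" "y \<in> tensor_space C k"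
  shows "tensor_power C k g (x - y) = tensor_power C k g x - tensor_power C k g y"
  using tensor_power_add[OF assms(1) subspace_scale[OF subspace_tensor_space assms(2)], of "-1"]
    tensor_power_scale[OF assms(2), of "-1"] by simp

lemma tensor_power_tendsto:
  assumes "\<And>n. u n \<in> tensor_space C k" "x \<in> tensor_space C k" "u \<longlonglongrightarrow> x"
  shows "(\<lambda>n. tensor_power C k g (u n)) \<longlonglongrightarrow> tensor_power C k g x"
proof -
  have "continuous_on (tensor_space C k) (tensor_power C k g)"
    using is_tensor_power_tensor_power[OF g] unfolding is_tensor_power_def by blast
  then show ?thesis
    using assms unfolding continuous_on_sequentially comp_def by blast
qed

lemma tensor_power_in:
  assumes "x \<in> tensor_space C k"
  shows "tensor_power C k g x \<in> tensor_space C k"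
  using assms
proof (induction rule: tensor_space_induct)
  case (tensor rs)
  then show ?case
    by (simp add: tensor_power_tensor tensor_in_tensor_space map_orthogonal_tuples)
next
  case (add x y)
  then show ?case by (simp add: tensor_power_add subspace_add[OF subspace_tensor_space])
next
  case (scale a x)
  then show ?case by (simp add: tensor_power_scale subspace_scale[OF subspace_tensor_space])
next
  case (limit u x)
  have "(\<lambda>n. tensor_power C k g (u n)) \<longlonglongrightarrow> tensor_power C k g x"
    using limit by (intro tensor_power_tendsto)
  then show ?case
    by (rule closed_sequentially[OF closed_tensor_space limit.IH])
qed

text \<open>Density induction in both arguments reduces this to pure tensors, whose inner product is
  the product of the inner products of their factors.\<close>

lemma inner_tensor_power:
  assumes "x \<in> tensor_space C k" "y \<in> tensor_space C k"
  shows "inner (tensor_power C k g x) (tensor_power C k g y) = inner x y"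
  using assms(1)
proof (induction rule: tensor_space_induct)
  case rs: (tensor rs)
  from assms(2) show ?case
  proof (induction rule: tensor_space_induct)
    case (tensor ss)
    have len: "length rs = k" "length ss = k"
      using rs tensor by (auto simp: tuples_def)
    have "inner (g (rs ! i)) (g (ss ! i)) = inner (rs ! i) (ss ! i)" if "i < k" for i
    proof -
      have "rs ! i \<in> ell2_on C" "ss ! i \<in> ell2_on C"
        using tensor rs that by (auto simp: tuples_def)
      then show ?thesis by (rule inner_orthogonal)
    qed
    then have "(\<Prod>i<k. inner (map g rs ! i) (map g ss ! i)) = (\<Prod>i<k. inner (rs ! i) (ss ! i))"
      using len by (intro prod.cong) simp_all
    then show ?case
      using len by (simp add: tensor_power_tensor rs tensor inner_tensor)
  next
    case (add x y)
    then show ?case by (simp add: tensor_power_add inner_add_right)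
  next
    case (scale a x)
    then show ?case by (simp add: tensor_power_scale)
  next
    case (limit u x)
    have "(\<lambda>n. inner (tensor_power C k g (tensor rs)) (tensor_power C k g (u n))) \<longlonglongrightarrow>
        inner (tensor_power C k g (tensor rs)) (tensor_power C k g x)"
      using limit by (intro tendsto_inner tendsto_const tensor_power_tendsto)
    moreover have "(\<lambda>n. inner (tensor rs) (u n)) \<longlonglongrightarrow> inner (tensor rs) x"
      using limit by (intro tendsto_inner tendsto_const)
    ultimately show ?case unfolding limit.IH by (rule LIMSEQ_unique)
  qed
next
  case (add x z)
  then show ?case by (simp add: tensor_power_add inner_add_left)
next
  case (scale a x)
  then show ?case by (simp add: tensor_power_scale)
next
  case (limit u x)
  have "(\<lambda>n. inner (tensor_power C k g (u n)) (tensor_power C k g y)) \<longlonglongrightarrow>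
      inner (tensor_power C k g x) (tensor_power C k g y)"
    using limit by (intro tendsto_inner tendsto_const tensor_power_tendsto)
  moreover have "(\<lambda>n. inner (u n) y) \<longlonglongrightarrow> inner x y"
    using limit by (intro tendsto_inner tendsto_const)
  ultimately show ?case unfolding limit.IH by (rule LIMSEQ_unique)
qed

lemma norm_tensor_power: "x \<in> tensor_space C k \<Longrightarrow> norm (tensor_power C k g x) = norm x"
  by (simp add: norm_eq_sqrt_inner inner_tensor_power)

text \<open>The induction runs over tensors with factors in \<open>ell2_on D\<close>, where
  \<open>g\<close> is the identity. Taking \<open>D = C\<close> shows that maps agreeing with the
  identity on \<open>H\<close> act trivially; smaller \<open>D\<close> serve the rotations of the
  regularity argument.\<close>

lemma tensor_power_fixes:
  assumes "D \<subseteq> C" and fixed: "\<And>x. x \<in> ell2_on D \<Longrightarrow> g x = x" and "x \<in> tensor_space D k"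
  shows "tensor_power C k g x = x"
proof -
  have DC: "y \<in> tensor_space C k" if "y \<in> tensor_space D k" for y
    using that \<open>D \<subseteq> C\<close> by (auto simp: tensor_space_def ell2_on_def tuples_def)
  from assms(3) show ?thesis
  proof (induction rule: tensor_space_induct)
    case (tensor rs)
    then have "rs \<in> tuples k (ell2_on C)" "map g rs = rs"
      using \<open>D \<subseteq> C\<close> fixed by (auto simp: tuples_def ell2_on_def intro!: map_idI)
    then show ?case by (simp add: tensor_power_tensor)
  next
    case (add x y)
    then show ?case by (simp add: tensor_power_add DC)
  next
    case (scale a x)
    then show ?case by (simp add: tensor_power_scale DC)
  next
    case (limit u x)
    have "(\<lambda>n. tensor_power C k g (u n)) \<longlonglongrightarrow> tensor_power C k g x"
      using limit by (intro tensor_power_tendsto DC)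
    then have "u \<longlonglongrightarrow> tensor_power C k g x" unfolding limit.IH .
    then show ?case using limit.hyps(3) by (rule LIMSEQ_unique)
  qed
qed

lemma pure_tensors_tensor_power:
  assumes "r \<in> pure_tensors C k"
  shows "tensor_power C k g r \<in> pure_tensors C k"
proof -
  obtain rs where r: "r = tensor rs" "rs \<in> tuples k (ell2_on C \<inter> cball 0 1)"
    using assms unfolding pure_tensors_def by blast
  then have "rs \<in> tuples k (ell2_on C)" "map g rs \<in> tuples k (ell2_on C \<inter> cball 0 1)"
    by (auto simp: tuples_def norm_orthogonal orthogonal_in subset_iff)
  then show ?thesis unfolding pure_tensors_def r(1) by (simp add: tensor_power_tensor)
qed

end

lemma tensor_power_comp:
  assumes g: "g \<in> orthogonal_group C" and h: "h \<in> orthogonal_group C" and "x \<in> tensor_space C k"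
  shows "tensor_power C k g (tensor_power C k h x) = tensor_power C k (g \<circ> h) x"
  using assms(3)
proof (induction rule: tensor_space_induct)
  case (tensor rs)
  show ?case
    unfolding tensor_power_tensor[OF h tensor] tensor_power_tensor[OF orthogonal_comp[OF g h] tensor]
      tensor_power_tensor[OF g map_orthogonal_tuples[OF h tensor]]
    by simp
next
  case (add x y)
  then show ?case
    by (simp only: tensor_power_add[OF g] tensor_power_add[OF h] tensor_power_add[OF orthogonal_comp[OF g h]]
        tensor_power_in[OF h])
next
  case (scale a x)
  then show ?case
    by (simp only: tensor_power_scale[OF g] tensor_power_scale[OF h]
        tensor_power_scale[OF orthogonal_comp[OF g h]] tensor_power_in[OF h])
next
  case (limit u x)
  have "(\<lambda>n. tensor_power C k g (tensor_power C k h (u n))) \<longlonglongrightarrow> tensor_power C k g (tensor_power C k h x)"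
    using limit by (intro tensor_power_tendsto[OF g] tensor_power_tendsto[OF h] tensor_power_in[OF h])
  moreover have "(\<lambda>n. tensor_power C k (g \<circ> h) (u n)) \<longlonglongrightarrow> tensor_power C k (g \<circ> h) x"
    using limit by (intro tensor_power_tendsto[OF orthogonal_comp[OF g h]])
  ultimately show ?case unfolding limit.IH by (rule LIMSEQ_unique)
qed

text \<open>One \<open>h\<close> serves all degrees \<open>k\<close>. The compositions with
  \<open>g\<close> are the identity on \<open>ell2_on C\<close> only, which is enough for their
  tensor powers.\<close>

lemma tensor_power_inverse:
  assumes g: "g \<in> orthogonal_group C"
  obtains h where "h \<in> orthogonal_group C"
    "\<And>k x. x \<in> tensor_space C k \<Longrightarrow> tensor_power C k h (tensor_power C k g x) = x"
    "\<And>k x. x \<in> tensor_space C k \<Longrightarrow> tensor_power C k g (tensor_power C k h x) = x"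
proof -
  obtain h where h: "h \<in> orthogonal_group C"
    and gh: "\<And>x. x \<in> ell2_on C \<Longrightarrow> g (h x) = x" and hg: "\<And>x. x \<in> ell2_on C \<Longrightarrow> h (g x) = x"
    by (rule orthogonal_inverse[OF g]) (rule that)
  show thesis
  proof
    show "tensor_power C k h (tensor_power C k g x) = x" if "x \<in> tensor_space C k" for k x
      using tensor_power_fixes[OF orthogonal_comp[OF h g] subset_refl _ that]
      by (simp add: tensor_power_comp[OF h g that] hg)
    show "tensor_power C k g (tensor_power C k h x) = x" if "x \<in> tensor_space C k" for k x
      using tensor_power_fixes[OF orthogonal_comp[OF g h] subset_refl _ that]
      by (simp add: tensor_power_comp[OF g h that] gh)
  qed (rule h)
qed

section \<open>Invariance of the metrics\<close>

lemma dual_dist_pure_tensors_le_iff: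
  "dual_dist (pure_tensors C k) x y \<le> e \<longleftrightarrow> (\<forall>r\<in>pure_tensors C k. \<bar>inner r (x - y)\<bar> \<le> e)"
  unfolding dual_dist_def
  by (rule cSUP_le_iff[OF pure_tensors_nonempty bdd_above_pure_tensors])

lemma pure_tensors_in_tensor_space: "r \<in> pure_tensors C k \<Longrightarrow> r \<in> tensor_space C k"
  using tensor_in_tensor_space[of _ k C] unfolding pure_tensors_def tuples_def by blast

text \<open>The inverse of \<open>g\<close> moves over to the test tensor in the inner product, and
  it maps pure tensors of the unit ball to such tensors. Applied to the inverse, this inequality
  also yields the reverse one.\<close>

lemma dual_dist_tensor_power_le:
  assumes g: "g \<in> orthogonal_group C" and x: "x \<in> tensor_space C k" and y: "y \<in> tensor_space C k"
  shows "dual_dist (pure_tensors C k) (tensor_power C k g x) (tensor_power C k g y) \<le>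
    dual_dist (pure_tensors C k) x y"
  unfolding dual_dist_pure_tensors_le_iff
proof
  fix r assume r: "r \<in> pure_tensors C k"
  obtain h where h: "h \<in> orthogonal_group C"
    "\<And>k x. x \<in> tensor_space C k \<Longrightarrow> tensor_power C k g (tensor_power C k h x) = x"
    using tensor_power_inverse[OF g] by metis
  note rt = pure_tensors_in_tensor_space[OF r]
  have xy: "x - y \<in> tensor_space C k" by (rule subspace_diff[OF subspace_tensor_space x y])
  have "inner r (tensor_power C k g x - tensor_power C k g y) =
      inner (tensor_power C k g (tensor_power C k h r)) (tensor_power C k g (x - y))"
    by (simp add: h(2)[OF rt] tensor_power_diff[OF g x y])
  also have "\<dots> = inner (tensor_power C k h r) (x - y)"
    by (rule inner_tensor_power[OF g tensor_power_in[OF h(1) rt] xy])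
  finally show "\<bar>inner r (tensor_power C k g x - tensor_power C k g y)\<bar> \<le> dual_dist (pure_tensors C k) x y"
    using dual_dist_pure_tensors_le_iff[THEN iffD1, OF order_refl] pure_tensors_tensor_power[OF h(1) r]
    by metis
qed

lemma dual_dist_tensor_power:
  assumes g: "g \<in> orthogonal_group C" and x: "x \<in> tensor_space C k" and y: "y \<in> tensor_space C k"
  shows "dual_dist (pure_tensors C k) (tensor_power C k g x) (tensor_power C k g y) =
    dual_dist (pure_tensors C k) x y"
proof (rule antisym[OF dual_dist_tensor_power_le[OF assms]])
  obtain h where h: "h \<in> orthogonal_group C"
    "\<And>k x. x \<in> tensor_space C k \<Longrightarrow> tensor_power C k h (tensor_power C k g x) = x"
    using tensor_power_inverse[OF g] by metis
  show "dual_dist (pure_tensors C k) x y \<le>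
      dual_dist (pure_tensors C k) (tensor_power C k g x) (tensor_power C k g y)"
    using dual_dist_tensor_power_le[OF h(1) tensor_power_in[OF g x] tensor_power_in[OF g y]]
    by (simp only: h(2) x y)
qed

section \<open>Invariance of the symmetric balls and of orbits\<close>

lemma bij_betw_permute_list:
  assumes "\<pi> permutes {..<k}"
  shows "bij_betw (permute_list \<pi>) (tuples k (UNIV :: 'a set)) (tuples k UNIV)"
proof (rule bij_betw_byWitness[where f' = "permute_list (inv \<pi>)"])
  have inv: "inv \<pi> permutes {..<k}" by (rule permutes_inv[OF assms])
  show "\<forall>a\<in>tuples k (UNIV :: 'a set). permute_list (inv \<pi>) (permute_list \<pi> a) = a"
  proof
    fix a :: "'a list" assume "a \<in> tuples k UNIV"
    then show "permute_list (inv \<pi>) (permute_list \<pi> a) = a"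
      using permute_list_compose[of "inv \<pi>" a \<pi>] inv assms
      by (simp add: in_tuples_UNIV permutes_inv_o)
  qed
  show "\<forall>a\<in>tuples k (UNIV :: 'a set). permute_list \<pi> (permute_list (inv \<pi>) a) = a"
  proof
    fix a :: "'a list" assume "a \<in> tuples k UNIV"
    then show "permute_list \<pi> (permute_list (inv \<pi>) a) = a"
      using permute_list_compose[of \<pi> a "inv \<pi>"] inv assms
      by (simp add: in_tuples_UNIV permutes_inv_o)
  qed
qed (auto simp: in_tuples_UNIV)

text \<open>A description of symmetry free of coordinates, hence one that can be carried through an
  orthogonal map. One direction reindexes the sum of the inner product by the permutation; the other
  tests with tensors of basis vectors.\<close>

lemma sym_tensor_space_iff_inner_tensor:
  assumes x: "x \<in> tensor_space C k"
  shows "x \<in> sym_tensor_space C k \<longleftrightarrow> (\<forall>\<pi>. \<pi> permutes {..<k} \<longrightarrow>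
    (\<forall>rs\<in>tuples k (ell2_on C). inner (tensor (permute_list \<pi> rs)) x = inner (tensor rs) x))"
    (is "_ \<longleftrightarrow> ?R")
proof
  assume sym: "x \<in> sym_tensor_space C k"
  show ?R
  proof (intro allI impI ballI)
    fix \<pi> and rs :: "'a ell2 list" assume \<pi>: "\<pi> permutes {..<k}" and "rs \<in> tuples k (ell2_on C)"
    then have len: "length rs = k" by (simp add: tuples_def)
    have eq: "ell2_at (tensor (permute_list \<pi> rs)) (permute_list \<pi> cs) * ell2_at x (permute_list \<pi> cs) =
        ell2_at (tensor rs) cs * ell2_at x cs" if cs: "cs \<in> tuples k UNIV" for cs
    proof -
      have lcs: "length cs = k" using cs by (simp add: in_tuples_UNIV)
      have "(\<Prod>i<k. ell2_at (permute_list \<pi> rs ! i) (permute_list \<pi> cs ! i)) =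
          (\<Prod>i<k. ell2_at (rs ! \<pi> i) (cs ! \<pi> i))"
        using \<pi> len lcs by (intro prod.cong) (auto simp: permute_list_nth)
      also have "\<dots> = (\<Prod>i<k. ell2_at (rs ! i) (cs ! i))"
        using prod.reindex_bij_betw[OF permutes_imp_bij[OF \<pi>], of "\<lambda>i. ell2_at (rs ! i) (cs ! i)"] .
      finally have "ell2_at (tensor (permute_list \<pi> rs)) (permute_list \<pi> cs) = ell2_at (tensor rs) cs"
        using len lcs by (simp add: ell2_at_tensor)
      moreover have "ell2_at x (permute_list \<pi> cs) = ell2_at x cs"
      proof (cases "cs \<in> tuples k C")
        case True
        then show ?thesis using sym \<pi> unfolding sym_tensor_space_def by blast
      next
        \<comment> \<open>Symmetry is only prescribed on tuples over \<open>C\<close>. Elsewhere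
          both coordinates vanish, since permuting a list keeps its set of entries.\<close>
        case False
        then have "permute_list \<pi> cs \<notin> tuples k C"
          using \<pi> lcs by (simp add: tuples_def)
        with False x show ?thesis unfolding tensor_space_def ell2_on_def by simp
      qed
      ultimately show ?thesis by simp
    qed
    \<comment> \<open>The sum is cut down to lists of length \<open>k\<close>, on which
      \<open>permute_list \<pi>\<close> is a bijection.\<close>
    have restr: "inner (tensor ss) x = (\<Sum>\<^sub>\<infinity>cs\<in>tuples k UNIV. ell2_at (tensor ss) cs * ell2_at x cs)"
      if "length ss = k" for ss
      unfolding inner_ell2_def using that
      by (intro infsum_cong_neutral) (auto simp: in_tuples_UNIV ell2_at_tensor)
    have "inner (tensor (permute_list \<pi> rs)) x = (\<Sum>\<^sub>\<infinity>cs\<in>tuples k UNIV.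
        ell2_at (tensor (permute_list \<pi> rs)) (permute_list \<pi> cs) * ell2_at x (permute_list \<pi> cs))"
      using infsum_reindex_bij_betw[OF bij_betw_permute_list[OF \<pi>],
          of "\<lambda>cs. ell2_at (tensor (permute_list \<pi> rs)) cs * ell2_at x cs"]
      by (simp add: restr len)
    also have "\<dots> = inner (tensor rs) x"
      unfolding restr[OF len] by (intro infsum_cong eq)
    finally show "inner (tensor (permute_list \<pi> rs)) x = inner (tensor rs) x" .
  qed
next
  assume R: ?R
  have "ell2_at x (permute_list \<pi> cs) = ell2_at x cs"
    if \<pi>: "\<pi> permutes {..<k}" and cs: "cs \<in> tuples k C" for \<pi> cs
  proof -
    have "map ell2_delta cs \<in> tuples k (ell2_on C)"
      using cs by (auto simp: tuples_def ell2_on_def ell2_at_delta)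
    with R \<pi> have "inner (tensor (permute_list \<pi> (map ell2_delta cs))) x =
        inner (tensor (map ell2_delta cs)) x"
      by blast
    moreover have "permute_list \<pi> (map ell2_delta cs) = map ell2_delta (permute_list \<pi> cs)"
      using \<pi> cs by (intro permute_list_map) (simp add: tuples_def)
    ultimately show ?thesis by (simp only: tensor_delta inner_delta)
  qed
  with x show "x \<in> sym_tensor_space C k" unfolding sym_tensor_space_def by blast
qed

lemma sym_ball_tensor_space: "x \<in> sym_ball C k \<Longrightarrow> x \<in> tensor_space C k"
  unfolding sym_ball_def sym_tensor_space_def by blast

text \<open>Pairing the image with a tensor amounts to pairing \<open>x\<close> with the tensor of
  the factors mapped by the inverse \<open>h\<close>, and \<open>map h\<close> commutes with
  permuting the list of factors.\<close>

lemma tensor_power_sym_ball: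
  assumes g: "g \<in> orthogonal_group C" and x: "x \<in> sym_ball C k"
  shows "tensor_power C k g x \<in> sym_ball C k"
proof -
  note xt = sym_ball_tensor_space[OF x]
  obtain h where h: "h \<in> orthogonal_group C"
    "\<And>k x. x \<in> tensor_space C k \<Longrightarrow> tensor_power C k g (tensor_power C k h x) = x"
    using tensor_power_inverse[OF g] by metis
  have adj: "inner (tensor rs) (tensor_power C k g x) = inner (tensor (map h rs)) x"
    if "rs \<in> tuples k (ell2_on C)" for rs
  proof -
    have t: "tensor rs \<in> tensor_space C k" by (rule tensor_in_tensor_space[OF that])
    have "inner (tensor rs) (tensor_power C k g x) =
        inner (tensor_power C k g (tensor_power C k h (tensor rs))) (tensor_power C k g x)"
      by (simp add: h(2)[OF t])
    also have "\<dots> = inner (tensor_power C k h (tensor rs)) x"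
      by (rule inner_tensor_power[OF g tensor_power_in[OF h(1) t] xt])
    finally show ?thesis by (simp add: tensor_power_tensor[OF h(1) that])
  qed
  have "tensor_power C k g x \<in> sym_tensor_space C k"
    unfolding sym_tensor_space_iff_inner_tensor[OF tensor_power_in[OF g xt]]
  proof (intro allI impI ballI)
    fix \<pi> rs assume \<pi>: "\<pi> permutes {..<k}" and rs: "rs \<in> tuples k (ell2_on C)"
    then have len: "length rs = k" by (simp add: tuples_def)
    have prs: "permute_list \<pi> rs \<in> tuples k (ell2_on C)"
      using \<pi> rs by (simp add: tuples_def)
    have "x \<in> sym_tensor_space C k" using x by (simp add: sym_ball_def)
    with \<pi> map_orthogonal_tuples[OF h(1) rs]
    have "inner (tensor (permute_list \<pi> (map h rs))) x = inner (tensor (map h rs)) x"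
      unfolding sym_tensor_space_iff_inner_tensor[OF xt] by blast
    then show "inner (tensor (permute_list \<pi> rs)) (tensor_power C k g x) =
        inner (tensor rs) (tensor_power C k g x)"
      using \<pi> len by (simp add: adj rs prs permute_list_map)
  qed
  moreover have "norm (tensor_power C k g x) \<le> 1"
    using x by (simp add: norm_tensor_power[OF g xt] sym_ball_def)
  ultimately show ?thesis by (simp add: sym_ball_def)
qed

text \<open>Composing group elements gives one inclusion; the same inclusion for the inverse of
  \<open>g\<close>, applied to the moved point, gives the other.\<close>

lemma orbit_tensor_power:
  assumes g: "g \<in> orthogonal_group C" and x: "\<And>k. x k \<in> tensor_space C k"
  shows "orbit C (\<lambda>k. tensor_power C k g (x k)) = orbit C x"
proof -
  have sub: "orbit C (\<lambda>k. tensor_power C k g (x k)) \<subseteq> orbit C x"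
    if g: "g \<in> orthogonal_group C" and x: "\<And>k. x k \<in> tensor_space C k" for g x
    using orthogonal_comp[OF _ g] tensor_power_comp[OF _ g x] unfolding orbit_def by fastforce
  obtain h where h: "h \<in> orthogonal_group C"
    "\<And>k x. x \<in> tensor_space C k \<Longrightarrow> tensor_power C k h (tensor_power C k g x) = x"
    using tensor_power_inverse[OF g] by metis
  show ?thesis
    using sub[OF g x] sub[OF h(1) tensor_power_in[OF g x]] h(2)[OF x] by auto
qed

lemma in_orbit_self:
  assumes x: "\<And>k. x k \<in> tensor_space C k"
  shows "x \<in> orbit C x"
proof -
  have "id \<in> orthogonal_group C" by (simp add: orthogonal_group_def)
  moreover have "x = (\<lambda>k. tensor_power C k id (x k))"
    using tensor_power_fixes[OF \<open>id \<in> _\<close> subset_refl _ x] by simp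
  ultimately show ?thesis unfolding orbit_def by blast
qed

section \<open>Completeness\<close>

text \<open>Hence \<open>d\<^sub>R\<close> dominates the difference in each single coordinate, and a
  Cauchy sequence converges pointwise.\<close>

lemma delta_in_pure_tensors: "cs \<in> tuples k C \<Longrightarrow> ell2_delta cs \<in> pure_tensors C k"
proof -
  assume "cs \<in> tuples k C"
  then have "map ell2_delta cs \<in> tuples k (ell2_on C \<inter> cball 0 1)"
    by (auto simp: tuples_def ell2_on_def ell2_at_delta norm_delta)
  then show ?thesis unfolding pure_tensors_def by (metis tensor_delta image_eqI)
qed

text \<open>Finite combinations of basis vectors are dense, and the uniform norm bound keeps the
  error of replacing \<open>r\<close> by such a combination independent of \<open>n\<close>.\<close>

lemma tendsto_inner_of_pointwise:
  fixes f :: "nat \<Rightarrow> 'a ell2"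
  assumes bound: "\<And>n. norm (f n) \<le> 1" and l: "norm l \<le> 1"
    and lim: "\<And>a. (\<lambda>n. ell2_at (f n) a) \<longlonglongrightarrow> ell2_at l a"
  shows "(\<lambda>n. inner r (f n)) \<longlonglongrightarrow> inner r l"
proof -
  have span: "(\<lambda>n. inner s (f n)) \<longlonglongrightarrow> inner s l" if "s \<in> span (range ell2_delta)" for s
    using that
  proof (induction rule: span_induct)
    case base
    show ?case
      by (rule subspaceI) (auto simp: inner_add_left intro!: tendsto_intros)
  next
    case (step s)
    then show ?case using lim by (auto simp: inner_delta)
  qed
  have "r \<in> closure (span (range ell2_delta))"
    using ell2_on_closure_span[of UNIV] by (auto simp: ell2_on_def)
  show ?thesis
  proof (rule metric_LIMSEQ_I)
    fix e :: real assume "0 < e"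
    \<comment> \<open>The quarter absorbs the factor 2 bounding
      \<open>norm (f n - l)\<close>.\<close>
    then obtain s where s: "s \<in> span (range ell2_delta)" "dist s r < e / 4"
      using \<open>r \<in> closure _\<close> unfolding closure_approachable
      by (metis zero_less_divide_iff zero_less_numeral)
    from metric_LIMSEQ_D[OF span[OF s(1)], of "e / 2"] \<open>0 < e\<close>
    obtain N where N: "\<And>n. n \<ge> N \<Longrightarrow> dist (inner s (f n)) (inner s l) < e / 2" by auto
    have "dist (inner r (f n)) (inner r l) < e" if "n \<ge> N" for n
    proof -
      have "\<bar>inner (r - s) (f n - l)\<bar> \<le> norm (r - s) * norm (f n - l)"
        by (rule Cauchy_Schwarz_ineq2)
      also have "\<dots> \<le> norm (r - s) * 2"
        using bound[of n] l norm_triangle_ineq4[of "f n" l] by (intro mult_left_mono) auto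
      also have "\<dots> < e / 2" using s(2) by (simp add: dist_norm norm_minus_commute)
      finally show ?thesis
        using N[OF that] unfolding dist_real_def inner_diff_left inner_diff_right by linarith
    qed
    then show "\<exists>N. \<forall>n\<ge>N. dist (inner r (f n)) (inner r l) < e" by blast
  qed
qed

text \<open>As in Fatou's lemma, the bound 1 passes to the limit in each finite partial sum of
  squares, and from there to the whole sum.\<close>

lemma ell2_pointwise_limit:
  fixes f :: "nat \<Rightarrow> 'a ell2"
  assumes bound: "\<And>n. norm (f n) \<le> 1" and conv: "\<And>a. convergent (\<lambda>n. ell2_at (f n) a)"
  obtains l where "norm l \<le> 1" "\<And>a. (\<lambda>n. ell2_at (f n) a) \<longlonglongrightarrow> ell2_at l a"
proof -
  obtain h where h: "\<And>a. (\<lambda>n. ell2_at (f n) a) \<longlonglongrightarrow> h a"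
    using conv unfolding convergent_def by metis
  have fin: "(\<Sum>a\<in>F. (h a)\<^sup>2) \<le> 1" if "finite F" for F
  proof (rule LIMSEQ_le_const2)
    show "(\<lambda>n. \<Sum>a\<in>F. (ell2_at (f n) a)\<^sup>2) \<longlonglongrightarrow> (\<Sum>a\<in>F. (h a)\<^sup>2)"
      by (intro tendsto_intros h)
    have "(norm (f n))\<^sup>2 \<le> 1" for n using bound[of n] by (simp add: power_le_one)
    then show "\<exists>N. \<forall>n\<ge>N. (\<Sum>a\<in>F. (ell2_at (f n) a)\<^sup>2) \<le> 1"
      using ell2_sum_le_norm[OF that] by (meson order_trans)
  qed
  then have sm: "(\<lambda>a. (h a)\<^sup>2) summable_on UNIV"
    by (intro nonneg_bdd_above_summable_on) (auto intro!: bdd_aboveI2)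
  then have at: "ell2_at (Abs_ell2 h) = h" by (simp add: Abs_ell2_inverse)
  show thesis
  proof
    have "(norm (Abs_ell2 h))\<^sup>2 \<le> 1"
      unfolding ell2_norm_sq at by (intro infsum_le_finite_sums sm fin)
    then show "norm (Abs_ell2 h) \<le> 1" by (simp add: abs_square_le_1)
    show "(\<lambda>n. ell2_at (f n) a) \<longlonglongrightarrow> ell2_at (Abs_ell2 h) a" for a using h at by simp
  qed
qed

lemma sym_ball_pointwise_closed:
  assumes f: "\<And>n. f n \<in> sym_ball C k" and l: "norm l \<le> 1"
    and lim: "\<And>cs. (\<lambda>n. ell2_at (f n) cs) \<longlonglongrightarrow> ell2_at l cs"
  shows "l \<in> sym_ball C k"
proof -
  have "ell2_at l cs = 0" if "cs \<notin> tuples k C" for cs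
  proof -
    have "ell2_at (f n) cs = 0" for n
      using f[of n] that by (auto simp: sym_ball_def sym_tensor_space_def tensor_space_def ell2_on_def)
    then have "(\<lambda>n. 0) \<longlonglongrightarrow> ell2_at l cs" using lim[of cs] by simp
    then show ?thesis by (rule LIMSEQ_unique[OF _ tendsto_const])
  qed
  moreover have "ell2_at l (permute_list \<pi> cs) = ell2_at l cs"
    if "\<pi> permutes {..<k}" "cs \<in> tuples k C" for \<pi> cs
  proof -
    have "ell2_at (f n) (permute_list \<pi> cs) = ell2_at (f n) cs" for n
      using f[of n] that unfolding sym_ball_def sym_tensor_space_def by blast
    then have "(\<lambda>n. ell2_at (f n) cs) \<longlonglongrightarrow> ell2_at l (permute_list \<pi> cs)"
      using lim[of "permute_list \<pi> cs"] by simp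
    then show ?thesis using lim[of cs] by (rule LIMSEQ_unique)
  qed
  ultimately have "l \<in> sym_tensor_space C k"
    unfolding sym_tensor_space_def tensor_space_def ell2_on_def by blast
  with l show ?thesis by (simp add: sym_ball_def)
qed

text \<open>Weak convergence alone is not uniform over the test tensors; the Cauchy condition
  supplies the uniformity. For fixed \<open>n\<close> the bound \<open>e / 2\<close> on
  \<open>\<bar>inner r (f n - f m)\<bar>\<close> persists as \<open>m\<close> tends to infinity,
  from an index \<open>N\<close> that does not depend on \<open>r\<close>.\<close>

lemma mcomplete_sym_ball: "Metric_space.mcomplete (sym_ball C k) (dual_dist (pure_tensors C k))"
proof -
  let ?R = "pure_tensors C k"
  interpret Metric_space "sym_ball C k" "dual_dist ?R" by (rule Metric_space_sym_ball)
  show ?thesis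
    unfolding mcomplete_def
  proof (intro allI impI)
    fix f assume "MCauchy f"
    then have f: "\<And>n. f n \<in> sym_ball C k"
      and cauchy: "\<And>e. 0 < e \<Longrightarrow> \<exists>N. \<forall>m n. N \<le> m \<longrightarrow> N \<le> n \<longrightarrow> dual_dist ?R (f m) (f n) < e"
      by (auto simp: MCauchy_def)
    have norm: "norm (f n) \<le> 1" for n using f[of n] by (simp add: sym_ball_def)
    have conv: "convergent (\<lambda>n. ell2_at (f n) cs)" for cs
    proof (cases "cs \<in> tuples k C")
      case False
      then have "ell2_at (f n) cs = 0" for n
        using f[of n] by (auto simp: sym_ball_def sym_tensor_space_def tensor_space_def ell2_on_def)
      then show ?thesis by (simp add: convergent_const)
    next
      case True
      have "Cauchy (\<lambda>n. ell2_at (f n) cs)"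
      proof (rule metric_CauchyI)
        fix e :: real assume "0 < e"
        then obtain N where N: "\<forall>m n. N \<le> m \<longrightarrow> N \<le> n \<longrightarrow> dual_dist ?R (f m) (f n) < e"
          using cauchy by blast
        have "dist (ell2_at (f m) cs) (ell2_at (f n) cs) \<le> dual_dist ?R (f m) (f n)" for m n
          using dual_dist_pure_tensors_le_iff[THEN iffD1, OF order_refl, rule_format,
              OF delta_in_pure_tensors[OF True], of "f m" "f n"]
          by (simp add: inner_delta minus_ell2.rep_eq dist_real_def)
        with N show "\<exists>N. \<forall>m\<ge>N. \<forall>n\<ge>N. dist (ell2_at (f m) cs) (ell2_at (f n) cs) < e"
          by (meson order_le_less_trans)
      qed
      then show ?thesis by (simp add: Cauchy_convergent_iff)
    qed
    from ell2_pointwise_limit[of f, OF norm conv] obtain l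
      where l: "norm l \<le> 1" "\<And>cs. (\<lambda>n. ell2_at (f n) cs) \<longlonglongrightarrow> ell2_at l cs" by blast
    have lS: "l \<in> sym_ball C k" by (rule sym_ball_pointwise_closed[OF f l])
    have weak: "(\<lambda>n. inner r (f n)) \<longlonglongrightarrow> inner r l" for r
      by (rule tendsto_inner_of_pointwise[OF norm l])
    have "\<exists>N. \<forall>n\<ge>N. dual_dist ?R (f n) l < e" if "0 < e" for e
    proof -
      obtain N where N: "\<And>m n. N \<le> m \<Longrightarrow> N \<le> n \<Longrightarrow> dual_dist ?R (f m) (f n) < e / 2"
        using cauchy[of "e / 2"] \<open>0 < e\<close> by auto
      have "dual_dist ?R (f n) l \<le> e / 2" if "N \<le> n" for n
        unfolding dual_dist_pure_tensors_le_iff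
      proof
        fix r assume "r \<in> ?R"
        have "(\<lambda>m. \<bar>inner r (f n - f m)\<bar>) \<longlonglongrightarrow> \<bar>inner r (f n - l)\<bar>"
          unfolding inner_diff_right by (intro tendsto_intros weak)
        moreover have "\<bar>inner r (f n - f m)\<bar> \<le> e / 2" if "N \<le> m" for m
          using N[OF \<open>N \<le> n\<close> that] \<open>r \<in> ?R\<close>
          by (meson dual_dist_pure_tensors_le_iff less_imp_le)
        ultimately show "\<bar>inner r (f n - l)\<bar> \<le> e / 2"
          by (blast intro: LIMSEQ_le_const2)
      qed
      moreover have "e / 2 < e" using \<open>0 < e\<close> by simp
      ultimately show ?thesis by (meson order_le_less_trans)
    qed
    then have "limitin mtopology f l sequentially"
      unfolding limitin_metric eventually_sequentially using f lS by blast
    then show "\<exists>x. limitin mtopology f x sequentially" ..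
  qed
qed

section \<open>Coordinate restrictions and reflections\<close>

text \<open>The orthogonal projection onto \<open>ell2_on A\<close>.\<close>

lift_definition ell2_restrict :: "'a set \<Rightarrow> 'a ell2 \<Rightarrow> 'a ell2" is "\<lambda>A f a. if a \<in> A then f a else 0"
proof -
  fix A :: "'a set" and f :: "'a \<Rightarrow> real"
  assume "(\<lambda>a. (f a)\<^sup>2) summable_on UNIV"
  then have "(\<lambda>a. (f a)\<^sup>2) summable_on A" by (rule summable_on_subset_banach) simp
  also have "?this \<longleftrightarrow> (\<lambda>a. (if a \<in> A then f a else 0)\<^sup>2) summable_on UNIV"
    by (rule summable_on_cong_neutral) auto
  finally show "(\<lambda>a. (if a \<in> A then f a else 0)\<^sup>2) summable_on UNIV" .
qed

lemma ell2_restrict_in: "ell2_restrict A x \<in> ell2_on A"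
  by (simp add: ell2_on_def ell2_restrict.rep_eq)

lemma ell2_restrict_in_superspace: "x \<in> ell2_on B \<Longrightarrow> ell2_restrict A x \<in> ell2_on B"
  by (simp add: ell2_on_def ell2_restrict.rep_eq)

lemma ell2_on_mono: "A \<subseteq> B \<Longrightarrow> ell2_on A \<subseteq> ell2_on B"
  by (auto simp: ell2_on_def)

lemma inner_ell2_restrict: "y \<in> ell2_on A \<Longrightarrow> inner y (ell2_restrict A x) = inner y x"
  unfolding inner_ell2_def by (intro infsum_cong) (auto simp: ell2_on_def ell2_restrict.rep_eq)

lemma ell2_restrict_restrict: "A \<subseteq> B \<Longrightarrow> ell2_restrict A (ell2_restrict B x) = ell2_restrict A x"
  by (rule ell2_eqI) (auto simp: ell2_restrict.rep_eq)

lemma ell2_restrict_diff: "ell2_restrict A (x - y) = ell2_restrict A x - ell2_restrict A y"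
  by (rule ell2_eqI) (simp add: ell2_restrict.rep_eq minus_ell2.rep_eq)

lemma ell2_restrict_pythagoras:
  "(norm x)\<^sup>2 = (norm (ell2_restrict A x))\<^sup>2 + (norm (x - ell2_restrict A x))\<^sup>2"
  using inner_ell2_restrict[OF ell2_restrict_in, of A x x]
  by (simp add: power2_norm_eq_inner inner_diff_left inner_diff_right inner_commute[of x "ell2_restrict A x"])

lemma norm_ell2_restrict_le: "norm (ell2_restrict A x) \<le> norm x"
  by (rule power2_le_imp_le) (use ell2_restrict_pythagoras[of x A] in simp_all)

lemma norm_sq_ell2_restrict_finite:
  assumes "finite A"
  shows "(norm (ell2_restrict A x))\<^sup>2 = (\<Sum>a\<in>A. (ell2_at x a)\<^sup>2)"
proof -
  have "(norm (ell2_restrict A x))\<^sup>2 = (\<Sum>\<^sub>\<infinity>a\<in>A. (ell2_at x a)\<^sup>2)"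
    unfolding ell2_norm_sq by (rule infsum_cong_neutral) (auto simp: ell2_restrict.rep_eq)
  with assms show ?thesis by simp
qed

text \<open>The Householder reflection exchanging the component of \<open>v\<close> orthogonal to \<open>ell2_on D\<close> with a
  multiple of \<open>ell2_delta c\<close>; if the two agree then \<open>w = 0\<close> and division by zero makes it the identity.\<close>

lemma orthogonal_group_move_vector:
  assumes "D \<subseteq> C" "c \<in> C - D" "v \<in> ell2_on C"
  obtains s where "s \<in> orthogonal_group C" "\<And>x. x \<in> ell2_on D \<Longrightarrow> s x = x"
    "s v \<in> ell2_on (insert c D)"
proof -
  define u where "u = v - ell2_restrict D v"
  define w where "w = u - norm u *\<^sub>R ell2_delta c"
  define s where "s x = x - (2 * inner w x / inner w w) *\<^sub>R w" for x
  note H = subspace_ell2_on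
  have delta: "ell2_delta c \<in> ell2_on (insert c D)" "ell2_delta c \<in> ell2_on C"
    using assms(2) by (auto simp: ell2_on_def ell2_at_delta)
  have uC: "u \<in> ell2_on C"
    unfolding u_def by (intro subspace_diff[OF H] assms(3) ell2_restrict_in_superspace)
  then have wC: "w \<in> ell2_on C"
    unfolding w_def by (intro subspace_diff[OF H] subspace_scale[OF H] delta)
  have sC: "s x \<in> ell2_on C" if "x \<in> ell2_on C" for x
    unfolding s_def by (intro subspace_diff[OF H] subspace_scale[OF H] wC that)
  have ws: "inner w (s x) = - inner w x" for x
    by (cases "w = 0") (auto simp: s_def inner_diff_right)
  then have ss: "s (s x) = x" for x
    by (simp add: s_def[of "s x"]) (simp add: s_def)
  have add: "s (x + y) = s x + s y" for x y
    by (simp add: s_def inner_add_right add_divide_distrib distrib_left scaleR_add_left)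
  have scale: "s (a *\<^sub>R x) = a *\<^sub>R s x" for a x
    by (simp add: s_def scaleR_diff_right)
  have inner: "inner (s x) (s y) = inner x y" for x y
  proof -
    have "inner (s x) (s y) = inner x (s y) - (2 * inner w x / inner w w) * inner w (s y)"
      by (subst s_def[of x]) (simp add: inner_diff_left)
    also have "\<dots> = inner x (s y) + (2 * inner w x / inner w w) * inner w y"
      by (simp add: ws)
    also have "\<dots> = inner x y"
      by (simp add: s_def inner_diff_right inner_commute[of x w])
    finally show ?thesis .
  qed
  have sO: "s \<in> orthogonal_group C"
    unfolding orthogonal_group_iff
  proof (intro conjI ballI allI add scale inner)
    show "s ` ell2_on C = ell2_on C"
    proof
      show "s ` ell2_on C \<subseteq> ell2_on C" using sC by blast
      show "ell2_on C \<subseteq> s ` ell2_on C" using sC ss by (metis image_eqI subsetI)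
    qed
  qed
  have u_orth: "inner u x = 0" if "x \<in> ell2_on D" for x
    using inner_ell2_restrict[OF that, of v]
    unfolding u_def inner_commute[of _ x] inner_diff_right by simp
  have w_orth: "inner w x = 0" if "x \<in> ell2_on D" for x
    using u_orth[OF that] that assms(2) by (simp add: w_def inner_diff_left inner_delta ell2_on_def)
  have fixed: "s x = x" if "x \<in> ell2_on D" for x
    using w_orth[OF that] by (simp add: s_def)
  have "inner w v = inner w u"
    using w_orth[OF ell2_restrict_in] by (simp add: u_def inner_diff_right)
  \<comment> \<open>This holds because \<open>u\<close> and
    \<open>norm u *\<^sub>R ell2_delta c\<close> have equal norm; it makes the reflection
    coefficient of \<open>v\<close> equal to 1 whenever \<open>w\<close> is nonzero.\<close>
  moreover have "inner w w = 2 * inner w u"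
    using dot_square_norm[of u]
    by (simp add: w_def inner_diff_left inner_diff_right inner_delta ell2_at_delta
        inner_commute[of u "ell2_delta c"] power2_eq_square algebra_simps)
  ultimately have "(2 * inner w v / inner w w) *\<^sub>R w = w" by (cases "w = 0") auto
  then have "s v = ell2_restrict D v + norm u *\<^sub>R ell2_delta c"
    by (simp add: s_def w_def u_def)
  moreover have "ell2_restrict D v \<in> ell2_on (insert c D)"
    using ell2_restrict_in[of D v] ell2_on_mono[of D "insert c D"] by blast
  ultimately have "s v \<in> ell2_on (insert c D)"
    using delta by (simp add: subspace_add[OF H] subspace_scale[OF H])
  with sO fixed that show thesis by blast
qed

text \<open>Each vector uses up one fresh coordinate \<open>c\<close>. Later reflections fix
  \<open>ell2_on (insert c D)\<close>, so a vector once moved stays in place. If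
  \<open>D' = C\<close> the identity works, however many vectors there are.\<close>

lemma orthogonal_group_move_vectors:
  assumes "finite D'" "D \<subseteq> D'" "D' \<subseteq> C" "set vs \<subseteq> ell2_on C" "D' = C \<or> length vs \<le> card (D' - D)"
  shows "\<exists>s\<in>orthogonal_group C. (\<forall>x\<in>ell2_on D. s x = x) \<and> s ` set vs \<subseteq> ell2_on D'"
  using assms(2,4,5)
proof (induction "length vs" arbitrary: vs D)
  case 0
  have "id \<in> orthogonal_group C" by (simp add: orthogonal_group_iff)
  with 0 show ?case by (intro bexI[of _ id]) auto
next
  case (Suc n)
  then obtain v vs' where vs: "vs = v # vs'" by (metis length_Suc_conv)
  show ?case
  proof (cases "D' = C")
    case True
    have "id \<in> orthogonal_group C" by (simp add: orthogonal_group_iff)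
    with Suc.prems(2) True show ?thesis by (intro bexI[of _ id]) auto
  next
    case False
    then have len: "Suc n \<le> card (D' - D)" using Suc by auto
    then obtain c where c: "c \<in> D' - D" by (metis card.empty ex_in_conv not_less_eq_eq zero_le)
    obtain s1 where s1: "s1 \<in> orthogonal_group C" "\<And>x. x \<in> ell2_on D \<Longrightarrow> s1 x = x"
      "s1 v \<in> ell2_on (insert c D)"
      using orthogonal_group_move_vector[of D C c v] c Suc.prems assms(3) vs by auto
    have sub: "set (map s1 vs') \<subseteq> ell2_on C"
      using Suc.prems(2) vs orthogonal_in[OF s1(1)] by auto
    have "card (D' - insert c D) = card (D' - D) - 1"
      using c assms(1) by (metis Diff_insert card_Diff_singleton)
    then have card: "length (map s1 vs') \<le> card (D' - insert c D)"
      using len Suc.hyps(2) vs by simp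
    have "\<exists>s\<in>orthogonal_group C. (\<forall>x\<in>ell2_on (insert c D). s x = x) \<and> s ` set (map s1 vs') \<subseteq> ell2_on D'"
      using Suc.hyps(1)[of "map s1 vs'" "insert c D"] Suc.hyps(2) vs c Suc.prems(1) sub card by simp
    then obtain s2 where s2: "s2 \<in> orthogonal_group C" "\<And>x. x \<in> ell2_on (insert c D) \<Longrightarrow> s2 x = x"
      "s2 ` set (map s1 vs') \<subseteq> ell2_on D'" by blast
    show ?thesis
    proof (intro bexI[of _ "s2 \<circ> s1"] conjI ballI)
      show "s2 \<circ> s1 \<in> orthogonal_group C" by (rule orthogonal_comp[OF s2(1) s1(1)])
      show "(s2 \<circ> s1) x = x" if "x \<in> ell2_on D" for x
        using s1(2)[OF that] s2(2)[of x] that ell2_on_mono[of D "insert c D"] by auto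
      have "s1 v \<in> ell2_on D'"
        using s1(3) ell2_on_mono[of "insert c D" D'] c Suc.prems(1) by blast
      then show "(s2 \<circ> s1) ` set vs \<subseteq> ell2_on D'"
        using s2(2)[OF s1(3)] s2(3) vs by auto
    qed
  qed
qed

lemma tuples_mono: "A \<subseteq> B \<Longrightarrow> tuples k A \<subseteq> tuples k B"
  by (auto simp: tuples_def)

text \<open>A coordinate over \<open>D\<close> is the inner product with a basis vector that the
  isometry fixes.\<close>

lemma ell2_restrict_tensor_power:
  assumes s: "s \<in> orthogonal_group C" and fixed: "\<And>x. x \<in> ell2_on D \<Longrightarrow> s x = x" and "D \<subseteq> C"
    and y: "y \<in> tensor_space C k"
  shows "ell2_restrict (tuples k D) (tensor_power C k s y) = ell2_restrict (tuples k D) y"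
proof (rule ell2_eqI)
  fix cs
  have "ell2_at (tensor_power C k s y) cs = ell2_at y cs" if "cs \<in> tuples k D"
  proof -
    have D: "ell2_delta cs \<in> tensor_space D k"
      using that by (auto simp: tensor_space_def ell2_on_def ell2_at_delta)
    then have C: "ell2_delta cs \<in> tensor_space C k"
      using ell2_on_mono[OF tuples_mono[OF \<open>D \<subseteq> C\<close>]] unfolding tensor_space_def by blast
    have "ell2_at (tensor_power C k s y) cs =
        inner (tensor_power C k s (ell2_delta cs)) (tensor_power C k s y)"
      using tensor_power_fixes[OF s \<open>D \<subseteq> C\<close> fixed D] by (simp add: inner_delta)
    also have "\<dots> = ell2_at y cs"
      using inner_tensor_power[OF s C y] by (simp add: inner_delta)
    finally show ?thesis .
  qed
  then show "ell2_at (ell2_restrict (tuples k D) (tensor_power C k s y)) cs =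
      ell2_at (ell2_restrict (tuples k D) y) cs"
    by (simp add: ell2_restrict.rep_eq)
qed

section \<open>Weak regularity\<close>

text \<open>A pure tensor witnessing that \<open>y k\<close> is far from its restriction to \<open>D\<close> can be rotated into
  \<open>D'\<close> without disturbing \<open>D\<close>; then \<open>D'\<close> captures \<open>\<epsilon>\<^sup>2\<close> more of the squared norm.\<close>

lemma energy_increment:
  assumes D: "finite D'" "D \<subseteq> D'" "D' \<subseteq> C" "D' = C \<or> k \<le> card (D' - D)"
    and y: "\<And>j. y j \<in> tensor_space C j" and "0 \<le> \<epsilon>"
    and far: "\<not> dual_dist (pure_tensors C k) (y k) (ell2_restrict (tuples k D) (y k)) \<le> \<epsilon>"
  obtains s where "s \<in> orthogonal_group C"
    "\<And>j. (norm (ell2_restrict (tuples j D) (y j)))\<^sup>2 \<le>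
      (norm (ell2_restrict (tuples j D') (tensor_power C j s (y j))))\<^sup>2"
    "(norm (ell2_restrict (tuples k D) (y k)))\<^sup>2 + \<epsilon>\<^sup>2 \<le>
      (norm (ell2_restrict (tuples k D') (tensor_power C k s (y k))))\<^sup>2"
proof -
  let ?P = "\<lambda>j. ell2_restrict (tuples j D)" and ?P' = "\<lambda>j. ell2_restrict (tuples j D')"
  have DC: "D \<subseteq> C" using D by blast
  obtain r where r: "r \<in> pure_tensors C k" "\<epsilon> < \<bar>inner r (y k - ?P k (y k))\<bar>"
    using far unfolding dual_dist_pure_tensors_le_iff by force
  then obtain rs where rs: "r = tensor rs" "length rs = k" "set rs \<subseteq> ell2_on C"
    unfolding pure_tensors_def tuples_def by blast
  obtain s where s: "s \<in> orthogonal_group C" "\<And>x. x \<in> ell2_on D \<Longrightarrow> s x = x" "s ` set rs \<subseteq> ell2_on D'"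
    using orthogonal_group_move_vectors[OF D(1-3) rs(3)] D(4) rs(2) by blast
  let ?T = "\<lambda>j. tensor_power C j s"
  have PT: "?P j (?T j (y j)) = ?P j (y j)" for j
    by (rule ell2_restrict_tensor_power[OF s(1,2) DC y])
  \<comment> \<open>Projecting on to \<open>D\<close> returns \<open>?P j (y j)\<close>, as
    \<open>s\<close> leaves the coordinates over \<open>D\<close> unchanged. The gain is therefore
    exactly the squared norm of a difference.\<close>
  have "(norm (?P' j (?T j (y j))))\<^sup>2 =
      (norm (?P j (y j)))\<^sup>2 + (norm (?P' j (?T j (y j)) - ?P j (y j)))\<^sup>2" for j
    using ell2_restrict_pythagoras[of "?P' j (?T j (y j))" "tuples j D"]
    by (simp add: ell2_restrict_restrict[OF tuples_mono[OF D(2)]] PT)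
  note pyth = this
  have "(?P k (y k)) \<in> tensor_space D k"
    unfolding tensor_space_def by (rule ell2_restrict_in)
  moreover have PyC: "?P k (y k) \<in> tensor_space C k"
    using y[of k] unfolding tensor_space_def by (rule ell2_restrict_in_superspace)
  ultimately have "?T k (?P k (y k)) = ?P k (y k)"
    by (intro tensor_power_fixes[OF s(1) DC s(2)])
  then have "?T k (y k - ?P k (y k)) = ?T k (y k) - ?P k (y k)"
    by (simp add: tensor_power_diff[OF s(1) y PyC])
  moreover have rC: "r \<in> tensor_space C k" by (rule pure_tensors_in_tensor_space[OF r(1)])
  moreover have yC: "y k - ?P k (y k) \<in> tensor_space C k"
    by (rule subspace_diff[OF subspace_tensor_space y PyC])
  ultimately have eq: "inner r (y k - ?P k (y k)) = inner (?T k r) (?T k (y k) - ?P k (y k))"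
    using inner_tensor_power[OF s(1) rC yC] by simp
  \<comment> \<open>The rotated witness lives over \<open>D'\<close>, so its inner products see only
    the part over \<open>D'\<close>; Cauchy-Schwarz then bounds that part from below.\<close>
  have "rs \<in> tuples k (ell2_on C)" "map s rs \<in> tuples k (ell2_on D')"
    using rs s(3) by (auto simp: tuples_def)
  then have "?T k r \<in> ell2_on (tuples k D')"
    using tensor_in_tensor_space[of "map s rs" k D'] by (simp add: rs(1) tensor_power_tensor[OF s(1)] tensor_space_def)
  from inner_ell2_restrict[OF this, of "?T k (y k) - ?P k (y k)"]
  have "inner r (y k - ?P k (y k)) = inner (?T k r) (?P' k (?T k (y k)) - ?P' k (?P k (y k)))"
    unfolding eq by (simp add: ell2_restrict_diff)
  also have "?P' k (?P k (y k)) = ?P k (y k)"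
    using tuples_mono[OF D(2), of k] by (intro ell2_eqI) (auto simp: ell2_restrict.rep_eq)
  finally have "\<epsilon> < \<bar>inner (?T k r) (?P' k (?T k (y k)) - ?P k (y k))\<bar>" using r(2) by simp
  also have "\<dots> \<le> norm (?T k r) * norm (?P' k (?T k (y k)) - ?P k (y k))"
    by (rule Cauchy_Schwarz_ineq2)
  also have "\<dots> \<le> 1 * norm (?P' k (?T k (y k)) - ?P k (y k))"
    using pure_tensors_norm[OF pure_tensors_tensor_power[OF s(1) r(1)]] by (intro mult_right_mono) auto
  finally have "\<epsilon>\<^sup>2 \<le> (norm (?P' k (?T k (y k)) - ?P k (y k)))\<^sup>2"
    using \<open>0 \<le> \<epsilon>\<close> by (intro power_mono) auto
  then show thesis
    using pyth[of k] by (intro that[OF s(1)]) (simp_all only: pyth add_left_mono le_add_same_cancel1 zero_le_power2)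
qed

text \<open>Every failure at stage \<open>i\<close> adds \<open>\<epsilon>\<^sup>2\<close> to the
  sum of squared norms in one degree and lowers it in none. After \<open>m\<close> failures the sum
  would exceed its bound \<open>Suc n\<close>. The bound \<open>m\<close> and the sets
  \<open>D i\<close> are the same for all \<open>y\<close>.\<close>

lemma weak_regularity:
  fixes y :: "nat \<Rightarrow> 'c list ell2" and D :: "nat \<Rightarrow> 'c set"
  assumes D: "\<And>i. finite (D i)" "\<And>i. D i \<subseteq> C" "\<And>i. D i \<subseteq> D (Suc i)"
      "\<And>i. D (Suc i) = C \<or> n \<le> card (D (Suc i) - D i)"
    and y: "\<And>k. y k \<in> tensor_space C k" "\<And>k. norm (y k) \<le> 1" and "0 \<le> \<epsilon>"
    and m: "real (Suc n) < real m * \<epsilon>\<^sup>2"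
  shows "\<exists>i<m. \<exists>g\<in>orthogonal_group C. \<forall>k\<le>n. dual_dist (pure_tensors C k)
    (tensor_power C k g (y k)) (ell2_restrict (tuples k (D i)) (tensor_power C k g (y k))) \<le> \<epsilon>"
proof (rule ccontr)
  assume no: "\<not> ?thesis"
  have "\<exists>g\<in>orthogonal_group C. real i * \<epsilon>\<^sup>2 \<le>
      (\<Sum>k\<le>n. (norm (ell2_restrict (tuples k (D i)) (tensor_power C k g (y k))))\<^sup>2)" if "i \<le> m" for i
    using that
  proof (induction i)
    case 0
    have "id \<in> orthogonal_group C" by (simp add: orthogonal_group_iff)
    then show ?case by (intro bexI[of _ id]) (simp_all add: sum_nonneg)
  next
    case (Suc i)
    then obtain g where g: "g \<in> orthogonal_group C" "real i * \<epsilon>\<^sup>2 \<le>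
      (\<Sum>k\<le>n. (norm (ell2_restrict (tuples k (D i)) (tensor_power C k g (y k))))\<^sup>2)" by auto
    define z where "z k = tensor_power C k g (y k)" for k
    have z: "z k \<in> tensor_space C k" for k unfolding z_def by (rule tensor_power_in[OF g(1) y(1)])
    obtain l where l: "l \<le> n"
      "\<not> dual_dist (pure_tensors C l) (z l) (ell2_restrict (tuples l (D i)) (z l)) \<le> \<epsilon>"
      using no g(1) Suc.prems unfolding z_def by (meson Suc_le_lessD)
    \<comment> \<open>A witness of degree \<open>l\<close> needs room for \<open>l\<close> factors,
      and \<open>n\<close> new coordinates suffice for every degree up to \<open>n\<close>.\<close>
    have "D (Suc i) = C \<or> l \<le> card (D (Suc i) - D i)" using D(4)[of i] l(1) by linarith
    from energy_increment[where y = z, OF D(1,3,2) this z \<open>0 \<le> \<epsilon>\<close> l(2)]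
    obtain s where s: "s \<in> orthogonal_group C"
      "\<And>k. (norm (ell2_restrict (tuples k (D i)) (z k)))\<^sup>2 \<le>
        (norm (ell2_restrict (tuples k (D (Suc i))) (tensor_power C k s (z k))))\<^sup>2"
      "(norm (ell2_restrict (tuples l (D i)) (z l)))\<^sup>2 + \<epsilon>\<^sup>2 \<le>
        (norm (ell2_restrict (tuples l (D (Suc i))) (tensor_power C l s (z l))))\<^sup>2"
      by blast
    let ?e = "\<lambda>k. (norm (ell2_restrict (tuples k (D i)) (z k)))\<^sup>2"
    let ?e' = "\<lambda>k. (norm (ell2_restrict (tuples k (D (Suc i))) (tensor_power C k s (z k))))\<^sup>2"
    have "real (Suc i) * \<epsilon>\<^sup>2 \<le> (\<Sum>k\<le>n. ?e k) + \<epsilon>\<^sup>2"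
      using g(2) by (simp add: z_def distrib_right)
    also have "\<dots> = (\<Sum>k\<le>n. ?e k + (if k = l then \<epsilon>\<^sup>2 else 0))"
      using l(1) by (simp add: sum.distrib)
    also have "\<dots> \<le> (\<Sum>k\<le>n. ?e' k)"
      using s(2,3) by (intro sum_mono) auto
    also have "\<dots> = (\<Sum>k\<le>n. (norm (ell2_restrict (tuples k (D (Suc i))) (tensor_power C k (s \<circ> g) (y k))))\<^sup>2)"
      unfolding z_def tensor_power_comp[OF s(1) g(1) y(1)] ..
    finally show ?case using orthogonal_comp[OF s(1) g(1)] by blast
  qed
  from this[of m] obtain g where g: "g \<in> orthogonal_group C" "real m * \<epsilon>\<^sup>2 \<le>
      (\<Sum>k\<le>n. (norm (ell2_restrict (tuples k (D m)) (tensor_power C k g (y k))))\<^sup>2)" by auto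
  note g(2)
  also have "(\<Sum>k\<le>n. (norm (ell2_restrict (tuples k (D m)) (tensor_power C k g (y k))))\<^sup>2) \<le> (\<Sum>k\<le>n. 1)"
  proof (intro sum_mono power_le_one norm_ge_zero)
    fix k
    show "norm (ell2_restrict (tuples k (D m)) (tensor_power C k g (y k))) \<le> 1"
      using norm_ell2_restrict_le y(2)[of k] norm_tensor_power[OF g(1) y(1)] by (metis order_trans)
  qed
  finally show False using m by simp
qed

section \<open>Finite nets and total boundedness modulo orbits\<close>

lemma increasing_finite_subsets:
  obtains D :: "nat \<Rightarrow> 'a set" where "\<And>i. finite (D i)" "\<And>i. D i \<subseteq> C" "\<And>i. D i \<subseteq> D (Suc i)"
    "\<And>i. D (Suc i) = C \<or> n \<le> card (D (Suc i) - D i)"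
proof (cases "finite C")
  case True
  then show thesis by (intro that[of "\<lambda>_. C"]) auto
next
  case False
  then obtain e :: "nat \<Rightarrow> 'a" where e: "inj e" "range e \<subseteq> C" using infinite_countable_subset by blast
  \<comment> \<open>Consecutive blocks of \<open>n\<close> elements along an injective enumeration,
    starting from the empty set.\<close>
  have "e ` {..<Suc i * n} - e ` {..<i * n} = e ` {i * n..<Suc i * n}" for i
    using e(1) by (auto simp: image_set_diff[symmetric])
  moreover have "card (e ` {i * n..<Suc i * n}) = n" for i
    using e(1) by (simp add: card_image inj_on_def)
  ultimately show thesis
    using e(2) by (intro that[of "\<lambda>i. e ` {..<i * n}"]) auto
qed

text \<open>Coordinates are rounded to a finite grid and one representative in \<open>S\<close> is
  kept for each rounding pattern. Grid points themselves would not do: the net has to inherit the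
  defining property of \<open>S\<close>.\<close>

lemma finite_net_of_restrictions:
  fixes S :: "(nat \<Rightarrow> 'c list ell2) set"
  assumes "finite D" and norm: "\<And>x k. x \<in> S \<Longrightarrow> norm (x k) \<le> 1" and "0 < \<epsilon>"
  obtains Z where "finite Z" "Z \<subseteq> S"
    "\<And>x. x \<in> S \<Longrightarrow> \<exists>z\<in>Z. \<forall>k\<le>n. norm (ell2_restrict (tuples k D) (z k - x k)) \<le> \<epsilon>"
proof -
  define A where "A = {cs. set cs \<subseteq> D \<and> length cs \<le> n}"
  have A: "finite A" unfolding A_def by (rule finite_lists_length_le[OF \<open>finite D\<close>])
  \<comment> \<open>Rounding leaves an error of at most \<open>1 / real M\<close> in each of at most
    \<open>card A\<close> coordinates, and the square of \<open>1 / real M\<close> is at most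
    \<open>1 / real M\<close>; so this choice keeps the squared norm below
    \<open>\<epsilon>\<^sup>2\<close>.\<close>
  obtain M :: nat where M: "real (card A) / \<epsilon>\<^sup>2 < real M" using reals_Archimedean2 by blast
  moreover have "0 \<le> real (card A) / \<epsilon>\<^sup>2" by simp
  ultimately have M0: "0 < real M" by linarith
  \<comment> \<open>The length of a list tells its degree, so one function on \<open>A\<close>
    records all degrees up to \<open>n\<close>.\<close>
  define f where "f x = (\<lambda>cs\<in>A. \<lfloor>real M * ell2_at (x (length cs)) cs\<rfloor>)" for x :: "nat \<Rightarrow> 'c list ell2"
  have "f x \<in> Pi\<^sub>E A (\<lambda>_. {- int M..int M})" if "x \<in> S" for x
  proof -
    have "- int M \<le> \<lfloor>real M * ell2_at (x (length cs)) cs\<rfloor> \<and> \<lfloor>real M * ell2_at (x (length cs)) cs\<rfloor> \<le> int M" for cs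
    proof -
      have "\<bar>ell2_at (x (length cs)) cs\<bar> \<le> 1"
        by (rule order_trans[OF ell2_at_le_norm norm[OF that]])
      then have "\<bar>real M * ell2_at (x (length cs)) cs\<bar> \<le> real M"
        using M0 by (simp add: abs_mult)
      then have "- real M \<le> real M * ell2_at (x (length cs)) cs"
        "real M * ell2_at (x (length cs)) cs < real M + 1"
        by linarith+
      then show ?thesis unfolding le_floor_iff floor_le_iff by simp
    qed
    then show ?thesis unfolding f_def restrict_PiE_iff atLeastAtMost_iff by blast
  qed
  then have "f ` S \<subseteq> Pi\<^sub>E A (\<lambda>_. {- int M..int M})" by blast
  then have "finite (f ` S)" by (rule finite_subset) (simp add: finite_PiE A)
  then obtain Z where Z: "Z \<subseteq> S" "finite Z" "f ` S = f ` Z"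
    using finite_subset_image[of "f ` S" f S] by blast
  show thesis
  proof
    fix x assume "x \<in> S"
    then obtain z where z: "z \<in> Z" "f z = f x" using Z(3) by (metis imageE imageI)
    have "norm (ell2_restrict (tuples k D) (z k - x k)) \<le> \<epsilon>" if "k \<le> n" for k
    proof (rule power2_le_imp_le)
      have sub: "tuples k D \<subseteq> A" using that by (auto simp: A_def tuples_def)
      then have fin: "finite (tuples k D)" using A finite_subset by blast
      have "(ell2_at (z k - x k) cs)\<^sup>2 \<le> (1 / real M)\<^sup>2" if cs: "cs \<in> tuples k D" for cs
      proof -
        have "\<lfloor>real M * ell2_at (z k) cs\<rfloor> = \<lfloor>real M * ell2_at (x k) cs\<rfloor>"
          using fun_cong[OF z(2), of cs] cs sub by (auto simp: f_def tuples_def split: if_splits)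
        then have "\<bar>real M * ell2_at (z k) cs - real M * ell2_at (x k) cs\<bar> \<le> 1"
          by linarith
        then have "real M * \<bar>ell2_at (z k) cs - ell2_at (x k) cs\<bar> \<le> 1"
          using M0 by (simp add: abs_mult flip: right_diff_distrib)
        then have "\<bar>ell2_at (z k - x k) cs\<bar> \<le> 1 / real M"
          using M0 by (simp add: minus_ell2.rep_eq field_simps)
        then show ?thesis by (metis abs_ge_zero power2_abs power_mono)
      qed
      then have "(norm (ell2_restrict (tuples k D) (z k - x k)))\<^sup>2 \<le> (\<Sum>cs\<in>tuples k D. (1 / real M)\<^sup>2)"
        unfolding norm_sq_ell2_restrict_finite[OF fin] by (rule sum_mono)
      also have "\<dots> \<le> real (card A) * (1 / real M)\<^sup>2"
        using card_mono[OF A sub] by (simp add: mult_right_mono)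
      also have "\<dots> \<le> real (card A) * (1 / real M)"
        using M0 by (intro mult_left_mono) (auto simp: power2_eq_square field_simps)
      also have "\<dots> \<le> \<epsilon>\<^sup>2"
        using M M0 \<open>0 < \<epsilon>\<close> by (simp add: field_simps)
      finally show "(norm (ell2_restrict (tuples k D) (z k - x k)))\<^sup>2 \<le> \<epsilon>\<^sup>2" .
    qed (use \<open>0 < \<epsilon>\<close> in simp)
    then show "\<exists>z\<in>Z. \<forall>k\<le>n. norm (ell2_restrict (tuples k D) (z k - x k)) \<le> \<epsilon>"
      using z(1) by blast
  qed (use Z in auto)
qed

lemma totally_bounded_modulo_orbits:
  "\<exists>Z. finite Z \<and> Z \<subseteq> Pi\<^sub>E UNIV (sym_ball C) \<and> (\<forall>x\<in>Pi\<^sub>E UNIV (sym_ball C).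
    \<exists>y\<in>Pi\<^sub>E UNIV (sym_ball C). \<exists>z\<in>Z. orbit C y = orbit C x \<and>
      near (\<lambda>k. dual_dist (pure_tensors C k)) n z y)"
proof -
  let ?X = "Pi\<^sub>E UNIV (sym_ball C)" and ?R = "pure_tensors C"
  \<comment> \<open>Three errors add up: from \<open>z\<close> to its restriction, between the two
    restrictions, and from the restriction of \<open>y\<close> back to \<open>y\<close>.\<close>
  define \<epsilon> where "\<epsilon> = (1/2 :: real) ^ n / 3"
  have \<epsilon>: "0 < \<epsilon>" by (simp add: \<epsilon>_def)
  obtain D where D: "\<And>i. finite (D i)" "\<And>i. D i \<subseteq> C" "\<And>i. D i \<subseteq> D (Suc i)"
    "\<And>i. D (Suc i) = C \<or> n \<le> card (D (Suc i) - D i)"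
    using increasing_finite_subsets[of C n] by blast
  obtain m :: nat where "real (Suc n) / \<epsilon>\<^sup>2 < real m" using reals_Archimedean2 by blast
  then have m: "real (Suc n) < real m * \<epsilon>\<^sup>2" using \<epsilon> by (simp add: pos_divide_less_eq)
  \<comment> \<open>The points that are regular for \<open>D i\<close>. Taking the net inside this
    set makes both \<open>z\<close> and \<open>y\<close> close to their restrictions.\<close>
  define S where "S i = {y \<in> ?X. \<forall>k\<le>n. dual_dist (?R k) (y k) (ell2_restrict (tuples k (D i)) (y k)) \<le> \<epsilon>}" for i
  have X: "x k \<in> sym_ball C k" "x k \<in> tensor_space C k" "norm (x k) \<le> 1" if "x \<in> ?X" for x k
  proof -
    show *: "x k \<in> sym_ball C k" using that by auto
    then show "x k \<in> tensor_space C k" by (rule sym_ball_tensor_space)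
    from * show "norm (x k) \<le> 1" by (simp add: sym_ball_def)
  qed
  have "\<exists>Z. finite Z \<and> Z \<subseteq> S i \<and>
    (\<forall>x\<in>S i. \<exists>z\<in>Z. \<forall>k\<le>n. norm (ell2_restrict (tuples k (D i)) (z k - x k)) \<le> \<epsilon>)" for i
  proof -
    have "norm (x k) \<le> 1" if "x \<in> S i" for x k using X(3) that by (simp add: S_def)
    with finite_net_of_restrictions[of "D i" "S i", OF D(1) _ \<epsilon>, of n] show ?thesis by metis
  qed
  then obtain Z where Z: "\<And>i. finite (Z i)" "\<And>i. Z i \<subseteq> S i"
    "\<And>i x. x \<in> S i \<Longrightarrow> \<exists>z\<in>Z i. \<forall>k\<le>n. norm (ell2_restrict (tuples k (D i)) (z k - x k)) \<le> \<epsilon>"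
    by metis
  show ?thesis
  proof (intro exI[of _ "\<Union>i<m. Z i"] conjI ballI)
    show "finite (\<Union>i<m. Z i)" using Z(1) by blast
    show "(\<Union>i<m. Z i) \<subseteq> ?X" using Z(2) unfolding S_def by blast
    fix x assume x: "x \<in> ?X"
    obtain i g where i: "i < m" and g: "g \<in> orthogonal_group C"
      and reg: "\<forall>k\<le>n. dual_dist (?R k) (tensor_power C k g (x k))
        (ell2_restrict (tuples k (D i)) (tensor_power C k g (x k))) \<le> \<epsilon>"
      using weak_regularity[where D = D and y = x, OF D X(2,3)[OF x] less_imp_le[OF \<epsilon>] m] by blast
    define y where "y k = tensor_power C k g (x k)" for k
    have yX: "y \<in> ?X" using tensor_power_sym_ball[OF g X(1)[OF x]] unfolding y_def by (intro PiE_I) simp_all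
    have yS: "y \<in> S i" using yX reg unfolding S_def y_def by blast
    then obtain z where z: "z \<in> Z i" "\<forall>k\<le>n. norm (ell2_restrict (tuples k (D i)) (z k - y k)) \<le> \<epsilon>"
      using Z(3) by blast
    have zS: "z \<in> S i" using z(1) Z(2) by blast
    have "near (\<lambda>k. dual_dist (?R k)) n z y"
      unfolding near_def dual_dist_pure_tensors_le_iff
    proof (intro allI impI ballI)
      fix k r assume k: "k \<le> n" and r: "r \<in> ?R k"
      let ?P = "ell2_restrict (tuples k (D i))"
      have "\<bar>inner r (z k - ?P (z k))\<bar> \<le> \<epsilon>" "\<bar>inner r (y k - ?P (y k))\<bar> \<le> \<epsilon>"
        using zS yS k r unfolding S_def dual_dist_pure_tensors_le_iff by blast+
      moreover have "\<bar>inner r (?P (z k - y k))\<bar> \<le> \<epsilon>"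
      proof -
        have "\<bar>inner r (?P (z k - y k))\<bar> \<le> norm r * norm (?P (z k - y k))"
          by (rule Cauchy_Schwarz_ineq2)
        also have "\<dots> \<le> 1 * \<epsilon>"
          using pure_tensors_norm[OF r] z(2) k by (intro mult_mono) auto
        finally show ?thesis by simp
      qed
      ultimately have "\<bar>inner r (z k - y k)\<bar> \<le> 3 * \<epsilon>"
        unfolding ell2_restrict_diff inner_diff_right by linarith
      then show "\<bar>inner r (z k - y k)\<bar> \<le> (1/2) ^ n" by (simp add: \<epsilon>_def)
    qed
    moreover have "orbit C y = orbit C x"
      unfolding y_def by (rule orbit_tensor_power[OF g X(2)[OF x]])
    ultimately show "\<exists>y\<in>?X. \<exists>z\<in>\<Union>i<m. Z i. orbit C y = orbit C x \<and> near (\<lambda>k. dual_dist (?R k)) n z y"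
      using yX z(1) i by blast
  qed
qed

text \<open>A point lies in its own orbit, so equal orbits provide one \<open>g\<close> taking
  \<open>y\<close> to \<open>x\<close>; its diagonal action is the required isometry.\<close>

lemma orbit_eq_imp_isometry:
  assumes x: "x \<in> Pi\<^sub>E UNIV (sym_ball C)" and y: "y \<in> Pi\<^sub>E UNIV (sym_ball C)" and eq: "orbit C x = orbit C y"
  shows "\<exists>\<phi>. \<phi> \<in> Pi\<^sub>E UNIV (sym_ball C) \<rightarrow> Pi\<^sub>E UNIV (sym_ball C) \<and> \<phi> y = x \<and>
    (\<forall>w\<in>Pi\<^sub>E UNIV (sym_ball C). orbit C (\<phi> w) = orbit C w) \<and>
    (\<forall>k. \<forall>v\<in>Pi\<^sub>E UNIV (sym_ball C). \<forall>w\<in>Pi\<^sub>E UNIV (sym_ball C).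
      dual_dist (pure_tensors C k) (\<phi> v k) (\<phi> w k) = dual_dist (pure_tensors C k) (v k) (w k))"
proof -
  let ?X = "Pi\<^sub>E UNIV (sym_ball C)"
  have ball: "w k \<in> sym_ball C k" if "w \<in> ?X" for w k using that by auto
  note ts = sym_ball_tensor_space[OF ball]
  have "x \<in> orbit C y" using in_orbit_self[OF ts[OF x]] eq by simp
  then obtain g where g: "g \<in> orthogonal_group C" "x = (\<lambda>k. tensor_power C k g (y k))"
    unfolding orbit_def by blast
  show ?thesis
  proof (intro exI[of _ "\<lambda>w k. tensor_power C k g (w k)"] conjI ballI allI)
    show "(\<lambda>w k. tensor_power C k g (w k)) \<in> ?X \<rightarrow> ?X"
      using tensor_power_sym_ball[OF g(1) ball] by (intro funcsetI PiE_I) simp_all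
    show "(\<lambda>k. tensor_power C k g (y k)) = x" using g(2) by simp
    show "orbit C (\<lambda>k. tensor_power C k g (w k)) = orbit C w" if "w \<in> ?X" for w
      by (rule orbit_tensor_power[OF g(1) ts[OF that]])
    show "dual_dist (pure_tensors C k) (tensor_power C k g (v k)) (tensor_power C k g (w k)) =
        dual_dist (pure_tensors C k) (v k) (w k)" if "v \<in> ?X" "w \<in> ?X" for k v w
      by (rule dual_dist_tensor_power[OF g(1) ts[OF that(1)] ts[OF that(2)]])
  qed
qed

theorem theorem3:
  fixes C :: "'c set"
  shows "compact_space
    (quotient_topology
      (product_topology
        (\<lambda>k. Metric_space.mtopology (sym_ball C k) (dual_dist (pure_tensors C k)))
        (UNIV :: nat set))
      (orbit C))"
  by (rule compact_space_quotient_of_isometric_product[OF Metric_space_sym_ball mcomplete_sym_ball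
        orbit_eq_imp_isometry totally_bounded_modulo_orbits])

end
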